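(* Let $n\ge 1$, let $W=W(A_n)$ be the Weyl group of type $A_n$ with fundamental system $\Pi$, and let $\sum_W(A_n)$ be the $\mathbb{Q}$-vector space having as basis the distinct equivalence classes $[x_J]$, $J\subseteq\Pi$, so that $\sum_W(A_n)=\mathrm{Sp}\{[x_J]\mid J\subseteq\Pi\}$. Then the rule $$[x_J][x_K]=\sum_{L\subseteq K}a_{JKL}[x_L]\qquad (J,K\subseteq\Pi),$$ extended bilinearly, is a well-defined multiplication making $\sum_W(A_n)$ an (associative) algebra over $\mathbb{Q}$ with identity $[x_\Pi]$.
   Context: Let $e_1,\dots,e_{n+1}$ be an orthonormal basis of a Euclidean space of dimension $n+1$. The root system of type $A_n$ is $\Phi=\{e_i-e_j\mid i\ne j,\ 1\le i,j\le n+1\}$ with fundamental system $\Pi=\{e_1-e_2,\dots,e_n-e_{n+1}\}$ and corresponding positive system $\Phi^+$; $W=W(A_n)$ is the group generated by the reflections $w_r$, $r\in\Phi$. For $J\subseteq\Pi$, $W_J$ is the standard parabolic subgroup generated by the $w_r$, $r\in J$, and $X_J=\{w\in W\mid w(J)\subseteq\Phi^+\}$ is the set of distinguished (minimal length) representatives of the left cosets $wW_J$ in $W$. Put $X_J^{-1}=\{w^{-1}\mid w\in X_J\}$ and $X_{JK}=X_J^{-1}\cap X_K$, the set of distinguished representatives of the double cosets $W_JwW_K$. Let $x_J=\sum_{d\in X_J}d\in\mathbb{Q}W$. For $J,K,L\subseteq\Pi$, $a_{JKL}$ is the number of $w\in X_{JK}$ with $w^{-1}(J)\cap K=L$. Write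 $J\sim K$ if $w(J)=K$ for some $w\in W$; define $x_J\sim x_K$ if and only if $J\sim K$. This is an equivalence relation on $\{x_J\mid J\subseteq\Pi\}$, and $[x_J]=\{x_K\mid K\subseteq\Pi,\ K\sim J\}$ is the class of $x_J$. *)

theory Defs
  imports
    "HOL-Analysis.Euclidean_Space"
    "HOL-Library.Poly_Mapping"
    "HOL-Algebra.Bij"
    "HOL-Algebra.Generated_Groups"
    "HOL-Algebra.Algebraic_Closure_Type"
    "HOL-Algebra.Module"
begin

unbundle inner_syntax

text \<open>The vectors of the orthonormal basis are \<open>e 1, \<dots>, e (n + 1)\<close>; the other values of \<open>e\<close> are
  never used.\<close>

definition roots :: "(nat \<Rightarrow> 'a::euclidean_space) \<Rightarrow> nat \<Rightarrow> 'a set" where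
  "roots e n = {e i - e j | i j. i \<in> {1..n+1} \<and> j \<in> {1..n+1} \<and> i \<noteq> j}"

definition simple_roots :: "(nat \<Rightarrow> 'a::euclidean_space) \<Rightarrow> nat \<Rightarrow> 'a set" where
  "simple_roots e n = {e i - e (i + 1) | i. i \<in> {1..n}}"

definition pos_roots :: "(nat \<Rightarrow> 'a::euclidean_space) \<Rightarrow> nat \<Rightarrow> 'a set" where
  "pos_roots e n = {r \<in> roots e n.
     \<exists>c. (\<forall>s\<in>simple_roots e n. c s \<ge> 0) \<and> r = (\<Sum>s\<in>simple_roots e n. c s *\<^sub>R s)}"

definition reflection :: "'a::euclidean_space \<Rightarrow> 'a \<Rightarrow> 'a" where
  "reflection r v = v - (2 * (v \<bullet> r) / (r \<bullet> r)) *\<^sub>R r"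

definition weyl_group :: "(nat \<Rightarrow> 'a::euclidean_space) \<Rightarrow> nat \<Rightarrow> ('a \<Rightarrow> 'a) set" where
  "weyl_group e n = generate (BijGroup UNIV) (reflection ` roots e n)"

definition dist_reps :: "(nat \<Rightarrow> 'a::euclidean_space) \<Rightarrow> nat \<Rightarrow> 'a set \<Rightarrow> ('a \<Rightarrow> 'a) set" where
  "dist_reps e n J = {w \<in> weyl_group e n. w ` J \<subseteq> pos_roots e n}"

definition dist_double_reps ::
    "(nat \<Rightarrow> 'a::euclidean_space) \<Rightarrow> nat \<Rightarrow> 'a set \<Rightarrow> 'a set \<Rightarrow> ('a \<Rightarrow> 'a) set" where
  "dist_double_reps e n J K = inv_into UNIV ` dist_reps e n J \<inter> dist_reps e n K"

definition struct_const ::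
    "(nat \<Rightarrow> 'a::euclidean_space) \<Rightarrow> nat \<Rightarrow> 'a set \<Rightarrow> 'a set \<Rightarrow> 'a set \<Rightarrow> nat" where
  "struct_const e n J K L =
     card {w \<in> dist_double_reps e n J K. inv_into UNIV w ` J \<inter> K = L}"

text \<open>Elements of the group algebra of \<open>W\<close> over the rationals are finitely supported functions
  with keys in \<open>W\<close>; \<open>Poly_Mapping.single d 1\<close> is the group element \<open>d\<close>. Only the additive
  structure is used, so the convolution product that \<^theory>\<open>HOL-Library.Poly_Mapping\<close> would
  attach to an additive type of keys plays no role.\<close>

definition x_elt ::
    "(nat \<Rightarrow> 'a::euclidean_space) \<Rightarrow> nat \<Rightarrow> 'a set \<Rightarrow> (('a \<Rightarrow> 'a) \<Rightarrow>\<^sub>0 rat)" where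
  "x_elt e n J = (\<Sum>d\<in>dist_reps e n J. Poly_Mapping.single d 1)"

definition root_equiv ::
    "(nat \<Rightarrow> 'a::euclidean_space) \<Rightarrow> nat \<Rightarrow> 'a set \<Rightarrow> 'a set \<Rightarrow> bool" where
  "root_equiv e n J K \<longleftrightarrow> (\<exists>w\<in>weyl_group e n. w ` J = K)"

definition x_class ::
    "(nat \<Rightarrow> 'a::euclidean_space) \<Rightarrow> nat \<Rightarrow> 'a set \<Rightarrow> (('a \<Rightarrow> 'a) \<Rightarrow>\<^sub>0 rat) set" where
  "x_class e n J = {x_elt e n K | K. K \<subseteq> simple_roots e n \<and> root_equiv e n K J}"

text \<open>The rational vector space with basis the set of distinct classes, realised as the finitely
  supported rational functions on that set. The class of \<open>x\<^sub>J\<close> as a basis vector is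
  \<open>basis_vec e n J\<close>.\<close>

type_synonym 'a class_vec = "(('a \<Rightarrow> 'a) \<Rightarrow>\<^sub>0 rat) set \<Rightarrow>\<^sub>0 rat"

definition class_space :: "(nat \<Rightarrow> 'a::euclidean_space) \<Rightarrow> nat \<Rightarrow> 'a class_vec set" where
  "class_space e n = {f. Poly_Mapping.keys f \<subseteq> x_class e n ` Pow (simple_roots e n)}"

definition scale :: "rat \<Rightarrow> ('b \<Rightarrow>\<^sub>0 rat) \<Rightarrow> ('b \<Rightarrow>\<^sub>0 rat)" where
  "scale q f = Poly_Mapping.map ((*) q) f"

definition basis_vec :: "(nat \<Rightarrow> 'a::euclidean_space) \<Rightarrow> nat \<Rightarrow> 'a set \<Rightarrow> 'a class_vec" where
  "basis_vec e n J = Poly_Mapping.single (x_class e n J) 1"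

definition product_rule ::
    "(nat \<Rightarrow> 'a::euclidean_space) \<Rightarrow> nat \<Rightarrow> 'a set \<Rightarrow> 'a set \<Rightarrow> 'a class_vec" where
  "product_rule e n J K =
     (\<Sum>L\<in>Pow K. scale (of_nat (struct_const e n J K L)) (basis_vec e n L))"

definition bilinear_on ::
    "('b \<Rightarrow>\<^sub>0 rat) set \<Rightarrow> (('b \<Rightarrow>\<^sub>0 rat) \<Rightarrow> ('b \<Rightarrow>\<^sub>0 rat) \<Rightarrow> ('b \<Rightarrow>\<^sub>0 rat)) \<Rightarrow> bool" where
  "bilinear_on V m \<longleftrightarrow>
     (\<forall>f\<in>V. \<forall>g\<in>V. m f g \<in> V) \<and>
     (\<forall>f\<in>V. \<forall>g\<in>V. \<forall>h\<in>V. m (f + g) h = m f h + m g h \<and> m h (f + g) = m h f + m h g) \<and>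
     (\<forall>q. \<forall>f\<in>V. \<forall>g\<in>V. m (scale q f) g = scale q (m f g) \<and> m f (scale q g) = scale q (m f g))"

definition extends_rule ::
    "(nat \<Rightarrow> 'a::euclidean_space) \<Rightarrow> nat \<Rightarrow> ('a class_vec \<Rightarrow> 'a class_vec \<Rightarrow> 'a class_vec) \<Rightarrow> bool" where
  "extends_rule e n m \<longleftrightarrow> bilinear_on (class_space e n) m \<and>
     (\<forall>J K. J \<subseteq> simple_roots e n \<and> K \<subseteq> simple_roots e n \<longrightarrow>
        m (basis_vec e n J) (basis_vec e n K) = product_rule e n J K)"

definition class_algebra ::
    "(nat \<Rightarrow> 'a::euclidean_space) \<Rightarrow> nat \<Rightarrow> ('a class_vec \<Rightarrow> 'a class_vec \<Rightarrow> 'a class_vec) \<Rightarrow>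
     (rat, 'a class_vec) module" where
  "class_algebra e n m = \<lparr>carrier = class_space e n, monoid.mult = m,
     one = basis_vec e n (simple_roots e n), ring.zero = 0, add = (+), module.smult = scale\<rparr>"

text \<open>The locale \<^locale>\<open>algebra\<close> of HOL-Algebra demands a commutative multiplication; the
  following is its analogue for associative unital algebras.\<close>

locale assoc_algebra = module + ring M +
  assumes smult_mult_left:
      "\<lbrakk>a \<in> carrier R; x \<in> carrier M; y \<in> carrier M\<rbrakk> \<Longrightarrow>
       (a \<odot>\<^bsub>M\<^esub> x) \<otimes>\<^bsub>M\<^esub> y = a \<odot>\<^bsub>M\<^esub> (x \<otimes>\<^bsub>M\<^esub> y)"
    and smult_mult_right:
      "\<lbrakk>a \<in> carrier R; x \<in> carrier M; y \<in> carrier M\<rbrakk> \<Longrightarrow>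
       x \<otimes>\<^bsub>M\<^esub> (a \<odot>\<^bsub>M\<^esub> y) = a \<odot>\<^bsub>M\<^esub> (x \<otimes>\<^bsub>M\<^esub> y)"

end

theory Submission
  imports Defs "HOL-Combinatorics.Permutations" "HOL-Analysis.Linear_Algebra"
begin

text \<open>Number the simple roots by \<open>1, \<dots>, n\<close> and put \<open>N = n + 1\<close>. For \<open>J, M \<subseteq> \<Pi>\<close> let the mark of \<open>J\<close> at \<open>M\<close>
  be the number of cosets in \<open>W/W\<^sub>J\<close> that are fixed by \<open>W\<^sub>M\<close>. The theorem holds because sending \<open>[x\<^sub>J]\<close> to the
  function \<open>M \<mapsto> mark of J at M\<close> identifies the space of classes, with the given rule, with a unital algebra of functions on the
  subsets of \<open>\<Pi>\<close> under pointwise multiplication. Three facts give this.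

  First, the marks obey the product rule (\<open>marks_mult\<close>). This is Mackey's formula: the \<open>W\<close>-set
  \<open>W/W\<^sub>J \<times> W/W\<^sub>K\<close> splits into orbits indexed by \<open>w \<in> X\<^bsub>JK\<^esub>\<close>, and the orbit of \<open>w\<close> is isomorphic to
  \<open>W/W\<^sub>L\<close> with \<open>L = w\<^sup>-\<^sup>1(J) \<inter> K\<close>. Here it is proved with words: \<open>W/W\<^sub>J\<close> is the set of rearrangements of a
  weakly increasing word of length \<open>N\<close> whose adjacent equal letters sit at the positions in \<open>J\<close>. A pair of
  words is one word in pairs of letters. Sorting it lexicographically turns the second word into
  its increasing form and the first into a word that increases weakly on each block of \<open>K\<close>; the
  standardization of the latter is the distinguished representative \<open>w\<close>.

  Second, marks depend on the class of \<open>J\<close> only (\<open>marks_class_cong\<close>), because an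
  element of \<open>W\<close> that conjugates two sets of simple roots carries the blocks of one to the blocks of the
  other, and the number of fixed points does not see how the letters are named.

  Third, the functions belonging to different classes are linearly independent
  (\<open>class_mark_independent\<close>), because the table of marks is triangular: if the mark of \<open>J\<close> at \<open>M\<close> is not
  zero, then some \<open>w \<in> W\<close> maps \<open>M\<close> into \<open>J\<close>, so either \<open>M\<close> has fewer elements or \<open>M \<sim> J\<close>
  (\<open>marks_nonzero_cases\<close>).

  Once the space of classes embeds into functions in this way, the right-hand side of the rule is determined
  by a pointwise product of two functions that depend on classes only. Hence it is well defined, and
  associativity and the identity \<open>[x\<^sub>\<Pi>]\<close> (whose marks are all \<open>1\<close>) come from the algebra of functions.\<close>

section \<open>Standardization of a word\<close>

text \<open>The position of \<open>i\<close> when the letters are sorted stably; this is the usual standardization of the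
  word \<open>f 1, \<dots>, f N\<close>. Positions outside \<open>{1..N}\<close> are left in place, so that it is a permutation of \<open>{1..N}\<close> in
  the sense of \<open>permutes\<close>.\<close>

definition standardize :: "nat \<Rightarrow> (nat \<Rightarrow> nat) \<Rightarrow> nat \<Rightarrow> nat" where
  "standardize N f i = (if i \<in> {1..N}
     then card {j \<in> {1..N}. f j < f i \<or> f j = f i \<and> j \<le> i} else i)"

lemma standardize_less:
  assumes "i \<in> {1..N}" "j \<in> {1..N}" "f i < f j \<or> f i = f j \<and> i < j"
  shows "standardize N f i < standardize N f j"
proof -
  have "{k \<in> {1..N}. f k < f i \<or> f k = f i \<and> k \<le> i} \<subset> {k \<in> {1..N}. f k < f j \<or> f k = f j \<and> k \<le> j}"
  proof (rule psubsetI)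
    show "{k \<in> {1..N}. f k < f i \<or> f k = f i \<and> k \<le> i} \<subseteq> {k \<in> {1..N}. f k < f j \<or> f k = f j \<and> k \<le> j}"
      using assms by auto
    have "j \<in> {k \<in> {1..N}. f k < f j \<or> f k = f j \<and> k \<le> j}" using assms by auto
    moreover have "j \<notin> {k \<in> {1..N}. f k < f i \<or> f k = f i \<and> k \<le> i}" using assms by auto
    ultimately show "{k \<in> {1..N}. f k < f i \<or> f k = f i \<and> k \<le> i} \<noteq> {k \<in> {1..N}. f k < f j \<or> f k = f j \<and> k \<le> j}"
      by blast
  qed
  then have "card {k \<in> {1..N}. f k < f i \<or> f k = f i \<and> k \<le> i} <
      card {k \<in> {1..N}. f k < f j \<or> f k = f j \<and> k \<le> j}"
    by (intro psubset_card_mono) simp_all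
  then show ?thesis using assms(1,2) by (simp add: standardize_def)
qed

lemma standardize_less_iff:
  assumes "i \<in> {1..N}" "j \<in> {1..N}"
  shows "standardize N f i < standardize N f j \<longleftrightarrow> f i < f j \<or> f i = f j \<and> i < j"
  using standardize_less[OF assms, of f] standardize_less[OF assms(2,1), of f]
  by (metis less_asym linorder_less_linear)

lemma standardize_permutes: "standardize N f permutes {1..N}"
proof (rule bij_imp_permutes)
  have inj: "inj_on (standardize N f) {1..N}"
    by (rule inj_onI) (metis standardize_less linorder_less_linear less_irrefl)
  have "standardize N f i \<in> {1..N}" if i: "i \<in> {1..N}" for i
  proof -
    have "card {j \<in> {1..N}. f j < f i \<or> f j = f i \<and> j \<le> i} \<le> card {1..N}"
      by (rule card_mono) auto
    moreover have "card {j \<in> {1..N}. f j < f i \<or> f j = f i \<and> j \<le> i} > 0"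
      using i by (auto simp: card_gt_0_iff)
    ultimately show ?thesis using i by (simp add: standardize_def)
  qed
  then have "standardize N f ` {1..N} = {1..N}"
    using inj by (intro endo_inj_surj) auto
  with inj show "bij_betw (standardize N f) {1..N} {1..N}" by (simp add: bij_betw_def)
qed (auto simp: standardize_def)

text \<open>A permutation is determined by the order in which it puts the positions: \<open>p i\<close> is the number of
  positions \<open>j\<close> with \<open>p j \<le> p i\<close>.\<close>

lemma standardize_unique:
  assumes p: "p permutes {1..N}"
    and less: "\<And>i j. i \<in> {1..N} \<Longrightarrow> j \<in> {1..N} \<Longrightarrow> f i < f j \<or> f i = f j \<and> i < j \<Longrightarrow> p i < p j"
  shows "p = standardize N f"
proof
  fix i
  show "p i = standardize N f i"
  proof (cases "i \<in> {1..N}")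
    case True
    then have pi: "p i \<in> {1..N}" using permutes_in_image[OF p] by blast
    have le_iff: "p j \<le> p i \<longleftrightarrow> f j < f i \<or> f j = f i \<and> j \<le> i" if j: "j \<in> {1..N}" for j
      using less[OF j True] less[OF True j] by (metis leD le_less linorder_less_linear)
    have "p ` {j \<in> {1..N}. p j \<le> p i} = {1..p i}"
    proof
      show "{1..p i} \<subseteq> p ` {j \<in> {1..N}. p j \<le> p i}"
      proof
        fix k assume k: "k \<in> {1..p i}"
        then have "k \<in> p ` {1..N}" using pi permutes_image[OF p] by auto
        then show "k \<in> p ` {j \<in> {1..N}. p j \<le> p i}" using k by auto
      qed
      show "p ` {j \<in> {1..N}. p j \<le> p i} \<subseteq> {1..p i}"
      proof
        fix k assume "k \<in> p ` {j \<in> {1..N}. p j \<le> p i}"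
        then obtain j where "j \<in> {1..N}" "p j \<le> p i" "k = p j" by blast
        moreover have "p j \<in> {1..N}" using permutes_in_image[OF p] calculation(1) by blast
        ultimately show "k \<in> {1..p i}" by simp
      qed
    qed
    then have "card {1..p i} = card {j \<in> {1..N}. p j \<le> p i}"
      by (metis card_image permutes_inj_on[OF p])
    also have "{j \<in> {1..N}. p j \<le> p i} = {j \<in> {1..N}. f j < f i \<or> f j = f i \<and> j \<le> i}"
      using le_iff by blast
    finally show ?thesis using True by (simp add: standardize_def)
  next
    case False
    then show ?thesis using permutes_not_in[OF p False] unfolding standardize_def by presburger
  qed
qed

text \<open>Sorting is unique at the level of words, although several permutations may sort the same word.\<close>

lemma mono_rearrangement_eq:
  fixes u v :: "nat \<Rightarrow> nat"
  assumes t: "t permutes {1..N}"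
    and u: "\<And>i j. 1 \<le> i \<Longrightarrow> i \<le> j \<Longrightarrow> j \<le> N \<Longrightarrow> u i \<le> u j"
    and v: "\<And>i j. 1 \<le> i \<Longrightarrow> i \<le> j \<Longrightarrow> j \<le> N \<Longrightarrow> v i \<le> v j"
    and vu: "\<And>i. i \<in> {1..N} \<Longrightarrow> v i = u (t i)"
    and i: "i \<in> {1..N}"
  shows "u i = v i"
proof -
  have "mset (map v [1..<Suc N]) = mset (map u [1..<Suc N])"
  proof -
    have "image_mset v (mset_set {1..N}) = image_mset (u \<circ> t) (mset_set {1..N})"
      by (rule image_mset_cong) (auto simp: vu)
    also have "\<dots> = image_mset u (image_mset t (mset_set {1..N}))"
      by (simp add: multiset.map_comp)
    also have "image_mset t (mset_set {1..N}) = mset_set {1..N}"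
      using t by (simp add: image_mset_mset_set permutes_inj_on permutes_image)
    finally show ?thesis by (simp only: mset_map mset_upt atLeastLessThanSuc_atLeastAtMost)
  qed
  moreover have "sorted (map u [1..<Suc N])" "sorted (map v [1..<Suc N])"
    using u v by (auto simp: sorted_iff_nth_mono simp del: upt_Suc)
  ultimately have "map v [1..<Suc N] = map u [1..<Suc N]"
    by (metis properties_for_sort)
  then show ?thesis using i by (auto simp del: upt_Suc)
qed

section \<open>The blocks of a set of adjacent positions\<close>

text \<open>A set \<open>A\<close> of positions glues each \<open>a \<in> A\<close> to \<open>Suc a\<close> and cuts \<open>{1..N}\<close> into intervals, the orbits of the
  parabolic subgroup \<open>W\<^sub>A\<close>. The number of the interval containing \<open>i\<close> is read as the \<open>i\<close>-th letter of a
  weakly increasing word, whose stabilizer is \<open>W\<^sub>A\<close>.\<close>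

definition block :: "nat set \<Rightarrow> nat \<Rightarrow> nat" where
  "block A i = card ({1..<i} - A)"

lemma block_mono: "i \<le> j \<Longrightarrow> block A i \<le> block A j"
  unfolding block_def by (rule card_mono) auto

lemma block_le: "i \<le> N \<Longrightarrow> block A i \<le> N"
proof -
  have "block A i \<le> card {1..<i}" unfolding block_def by (rule card_mono) auto
  then show "i \<le> N \<Longrightarrow> block A i \<le> N" by simp
qed

lemma block_eq_iff:
  assumes "1 \<le> i" "i \<le> j"
  shows "block A i = block A j \<longleftrightarrow> {i..<j} \<subseteq> A"
proof -
  have "{1..<j} - A = ({1..<i} - A) \<union> ({i..<j} - A)" using assms by auto
  then have "block A j = block A i + card ({i..<j} - A)"
    unfolding block_def by (auto intro: card_Un_disjoint)
  then show ?thesis by (simp add: Diff_eq_empty_iff)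
qed

lemma block_Suc_eq_iff: "1 \<le> i \<Longrightarrow> block A i = block A (Suc i) \<longleftrightarrow> i \<in> A"
  by (subst block_eq_iff) auto

lemma adjacent_rise_mono:
  fixes f :: "nat \<Rightarrow> nat"
  assumes "\<And>k. k \<in> {i..<j} \<Longrightarrow> f k \<le> f (Suc k)" "i \<le> j"
  shows "f i \<le> f j"
  using assms(2,1)
proof (induction rule: dec_induct)
  case (step m)
  then have "f i \<le> f m" by simp
  also have "f m \<le> f (Suc m)" using step by simp
  finally show ?case .
qed simp

lemma adjacent_rise_strict:
  fixes f :: "nat \<Rightarrow> nat"
  assumes "\<And>k. k \<in> {i..<j} \<Longrightarrow> f k < f (Suc k)" "i < j"
  shows "f i < f j"
proof -
  have "f (Suc i) \<le> f j"
  proof (rule adjacent_rise_mono[where f = f])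
    fix k assume "k \<in> {Suc i..<j}"
    then have "k \<in> {i..<j}" by simp
    then show "f k \<le> f (Suc k)" by (rule less_imp_le[OF assms(1)])
  qed (use assms(2) in simp)
  moreover have "f i < f (Suc i)" by (rule assms(1)) (use assms(2) in simp)
  ultimately show ?thesis by simp
qed

section \<open>Rearrangements and marks\<close>

text \<open>The points of the \<open>W\<close>-orbit of the word \<open>p\<close> that are fixed by \<open>W\<^sub>M\<close>. For \<open>p = block A\<close> the orbit is a model of
  \<open>W/W\<^sub>A\<close>. Words are restricted to \<open>{1..N}\<close> because a word is a function on all of \<open>nat\<close> and only these letters
  matter.\<close>

definition arrangements :: "nat \<Rightarrow> (nat \<Rightarrow> 'b) \<Rightarrow> nat set \<Rightarrow> (nat \<Rightarrow> 'b) set" where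
  "arrangements N p M =
     {restrict (p \<circ> s) {1..N} | s. s permutes {1..N} \<and> (\<forall>m\<in>M. p (s m) = p (s (Suc m)))}"

definition marks :: "nat \<Rightarrow> nat set \<Rightarrow> nat set \<Rightarrow> nat" where
  "marks N A M = card (arrangements N (block A) M)"

lemma finite_arrangements: "finite (arrangements N p M)"
proof (rule finite_subset)
  show "arrangements N p M \<subseteq> (\<lambda>s. restrict (p \<circ> s) {1..N}) ` {s. s permutes {1..N}}"
    by (auto simp: arrangements_def)
qed (simp add: finite_permutations)

text \<open>Only the pattern of equal letters matters: a bijective renaming \<open>\<phi>\<close> of the letters of \<open>q\<close> turns it into \<open>p\<close>.
  The letters may have different types, which allows words in pairs to be compared with words in numbers.\<close>

lemma card_arrangements_cong:
  assumes ker: "\<And>i j. i \<in> {1..N} \<Longrightarrow> j \<in> {1..N} \<Longrightarrow> p i = p j \<longleftrightarrow> q i = q j"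
    and M: "M \<subseteq> {1..<N}"
  shows "card (arrangements N p M) = card (arrangements N q M)"
proof -
  define \<phi> where "\<phi> = p \<circ> inv_into {1..N} q"
  have \<phi>: "\<phi> (q i) = p i" if "i \<in> {1..N}" for i
  proof -
    have "q i \<in> q ` {1..N}" using that by blast
    then show ?thesis
      using ker[OF inv_into_into that] f_inv_into_f unfolding \<phi>_def comp_def by metis
  qed
  have fixed: "(\<forall>m\<in>M. p (s m) = p (s (Suc m))) \<longleftrightarrow> (\<forall>m\<in>M. q (s m) = q (s (Suc m)))"
    if "s permutes {1..N}" for s
  proof (intro ball_cong refl ker)
    fix m assume "m \<in> M"
    then have "m \<in> {1..N}" "Suc m \<in> {1..N}" using M by auto
    then show "s m \<in> {1..N}" "s (Suc m) \<in> {1..N}" using permutes_in_image[OF that] by blast+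
  qed
  have comp: "restrict (\<phi> \<circ> restrict (q \<circ> s) {1..N}) {1..N} = restrict (p \<circ> s) {1..N}"
    if "s permutes {1..N}" for s
    using permutes_in_image[OF that] by (auto simp: restrict_def fun_eq_iff \<phi>)
  have "bij_betw (\<lambda>h. restrict (\<phi> \<circ> h) {1..N}) (arrangements N q M) (arrangements N p M)"
    unfolding bij_betw_def
  proof
    show "inj_on (\<lambda>h. restrict (\<phi> \<circ> h) {1..N}) (arrangements N q M)"
    proof (rule inj_onI)
      fix g h assume "g \<in> arrangements N q M" "h \<in> arrangements N q M"
        and eq: "restrict (\<phi> \<circ> g) {1..N} = restrict (\<phi> \<circ> h) {1..N}"
      then obtain s t where s: "s permutes {1..N}" "g = restrict (q \<circ> s) {1..N}"
        and t: "t permutes {1..N}" "h = restrict (q \<circ> t) {1..N}"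
        by (auto simp: arrangements_def)
      have "restrict (p \<circ> s) {1..N} = restrict (p \<circ> t) {1..N}"
        using eq comp[OF s(1)] comp[OF t(1)] s(2) t(2) by simp
      then have "p (s i) = p (t i)" if "i \<in> {1..N}" for i
        using that by (metis comp_apply restrict_apply')
      then have "q (s i) = q (t i)" if "i \<in> {1..N}" for i
        using that ker permutes_in_image[OF s(1)] permutes_in_image[OF t(1)] by blast
      then show "g = h" by (auto simp: s t)
    qed
    show "(\<lambda>h. restrict (\<phi> \<circ> h) {1..N}) ` arrangements N q M = arrangements N p M"
    proof (intro subset_antisym subsetI)
      fix h assume "h \<in> (\<lambda>h. restrict (\<phi> \<circ> h) {1..N}) ` arrangements N q M"
      then show "h \<in> arrangements N p M"
        unfolding arrangements_def using comp fixed by blast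
    next
      fix h assume "h \<in> arrangements N p M"
      then obtain s where s: "s permutes {1..N}" "h = restrict (p \<circ> s) {1..N}"
          "\<forall>m\<in>M. p (s m) = p (s (Suc m))"
        by (auto simp: arrangements_def)
      then have "restrict (q \<circ> s) {1..N} \<in> arrangements N q M"
        using fixed unfolding arrangements_def by blast
      then show "h \<in> (\<lambda>h. restrict (\<phi> \<circ> h) {1..N}) ` arrangements N q M"
        using comp[OF s(1)] s(2) by (metis image_eqI)
    qed
  qed
  then show ?thesis by (metis bij_betw_same_card)
qed

lemma arrangements_comp:
  assumes t: "t permutes {1..N}"
  shows "arrangements N (p \<circ> t) M = arrangements N p M"
proof
  show "arrangements N (p \<circ> t) M \<subseteq> arrangements N p M"
  proof
    fix h assume "h \<in> arrangements N (p \<circ> t) M"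
    then obtain s where s: "s permutes {1..N}" "h = restrict (p \<circ> t \<circ> s) {1..N}"
          "\<forall>m\<in>M. (p \<circ> t) (s m) = (p \<circ> t) (s (Suc m))"
      by (auto simp: arrangements_def)
    have "(t \<circ> s) permutes {1..N}" using permutes_compose[OF s(1) t] .
    moreover have "h = restrict (p \<circ> (t \<circ> s)) {1..N}"
      unfolding s(2) by (simp add: comp_assoc)
    moreover have "\<forall>m\<in>M. p ((t \<circ> s) m) = p ((t \<circ> s) (Suc m))"
      using s(3) by simp
    ultimately show "h \<in> arrangements N p M"
      unfolding arrangements_def by blast
  qed
  show "arrangements N p M \<subseteq> arrangements N (p \<circ> t) M"
  proof
    fix h assume "h \<in> arrangements N p M"
    then obtain s where s: "s permutes {1..N}" "h = restrict (p \<circ> s) {1..N}"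
          "\<forall>m\<in>M. p (s m) = p (s (Suc m))"
      by (auto simp: arrangements_def)
    have t': "t (inv_into UNIV t x) = x" for x using t by (simp add: permutes_inverses)
    have "(inv_into UNIV t \<circ> s) permutes {1..N}" using permutes_compose[OF s(1) permutes_inv[OF t]] .
    moreover have "h = restrict ((p \<circ> t) \<circ> (inv_into UNIV t \<circ> s)) {1..N}"
      unfolding s(2) by (simp add: comp_def t')
    moreover have "\<forall>m\<in>M. (p \<circ> t) ((inv_into UNIV t \<circ> s) m) = (p \<circ> t) ((inv_into UNIV t \<circ> s) (Suc m))"
      using s(3) by (simp add: t')
    ultimately show "h \<in> arrangements N (p \<circ> t) M"
      unfolding arrangements_def by blast
  qed
qed

section \<open>Double coset representatives and the product of marks\<close>

text \<open>The permutations that describe \<open>X\<^bsub>AB\<^esub>\<close>: increasing on the blocks of \<open>B\<close>, with inverse increasing on the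
  blocks of \<open>A\<close>.\<close>

definition double_perms :: "nat \<Rightarrow> nat set \<Rightarrow> nat set \<Rightarrow> (nat \<Rightarrow> nat) set" where
  "double_perms N A B = {w. w permutes {1..N} \<and> (\<forall>b\<in>B. w b < w (Suc b)) \<and>
     (\<forall>a\<in>A. inv_into UNIV w a < inv_into UNIV w (Suc a))}"

text \<open>In terms of roots this is \<open>w\<^sup>-\<^sup>1(A) \<inter> B\<close>; for \<open>w\<close> in \<open>double_perms N A B\<close> it
  generates the parabolic subgroup \<open>w\<^sup>-\<^sup>1 W\<^sub>A w \<inter> W\<^sub>B\<close>.\<close>

definition stab_meet :: "nat set \<Rightarrow> nat set \<Rightarrow> (nat \<Rightarrow> nat) \<Rightarrow> nat set" where
  "stab_meet A B w = {b \<in> B. w b \<in> A \<and> w (Suc b) = Suc (w b)}"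

lemma inv_less_in_block:
  assumes w: "w permutes {1..N}"
    and inc: "\<forall>a\<in>A. inv_into UNIV w a < inv_into UNIV w (Suc a)"
    and i: "i \<in> {1..N}" and lt: "w i < w j" and eq: "block A (w i) = block A (w j)"
  shows "i < j"
proof -
  have "1 \<le> w i" using permutes_in_image[OF w, of i] i by auto
  then have sub: "{w i..<w j} \<subseteq> A" using block_eq_iff[of "w i" "w j" A] lt eq by simp
  have "inv_into UNIV w (w i) < inv_into UNIV w (w j)"
  proof (rule adjacent_rise_strict[where f = "inv_into UNIV w"])
    fix k assume "k \<in> {w i..<w j}"
    then show "inv_into UNIV w k < inv_into UNIV w (Suc k)" using sub inc by blast
  qed (rule lt)
  then show ?thesis by (simp add: permutes_inverses(2)[OF w])
qed

text \<open>A distinguished representative \<open>w\<close> can be recovered from the word \<open>block A \<circ> w\<close>: the word decides the order of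
  \<open>w i\<close> and \<open>w j\<close> when its letters differ, and when they agree the inverse of \<open>w\<close> is increasing.\<close>

lemma double_perm_eq_standardize:
  assumes "w \<in> double_perms N A B"
  shows "w = standardize N (block A \<circ> w)"
proof (rule standardize_unique)
  show w: "w permutes {1..N}" using assms by (simp add: double_perms_def)
  fix i j assume i: "i \<in> {1..N}" and j: "j \<in> {1..N}"
    and key: "(block A \<circ> w) i < (block A \<circ> w) j \<or> (block A \<circ> w) i = (block A \<circ> w) j \<and> i < j"
  from key show "w i < w j"
  proof
    assume "(block A \<circ> w) i < (block A \<circ> w) j"
    then show ?thesis using block_mono[of "w j" "w i" A] by (metis comp_apply not_le)
  next
    assume eq: "(block A \<circ> w) i = (block A \<circ> w) j \<and> i < j"
    show ?thesis
    proof (rule ccontr)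
      assume "\<not> w i < w j"
      moreover have "w i \<noteq> w j" using eq permutes_inj[OF w] by (metis injD less_irrefl)
      ultimately have "w j < w i" by simp
      then have "j < i"
        using inv_less_in_block[OF w _ j, of A i] eq assms by (simp add: double_perms_def)
      then show False using eq by simp
    qed
  qed
qed

lemma double_perm_increasing:
  assumes w: "w \<in> double_perms N A B" and ij: "1 \<le> i" "i < j" and eq: "block B i = block B j"
  shows "w i < w j"
proof (rule adjacent_rise_strict[where f = w])
  have sub: "{i..<j} \<subseteq> B" using block_eq_iff[of i j B] ij eq by simp
  fix k assume "k \<in> {i..<j}"
  then show "w k < w (Suc k)" using sub w by (auto simp: double_perms_def)
qed (rule ij)

text \<open>The word of pairs attached to \<open>w\<close> has the same equalities between letters as the word of
  \<open>stab_meet A B w\<close>. If the pairs at \<open>i < j\<close> agree, then \<open>w\<close> is increasing on \<open>[i, j]\<close> and its inverse is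
  increasing on \<open>[w i, w j]\<close>. So \<open>w\<close> maps one interval onto the other by a shift, and every
  simple root in between goes to a simple root in \<open>A\<close>.\<close>

lemma stab_meet_kernel_le:
  assumes w: "w \<in> double_perms N A B" and ij: "1 \<le> i" "i \<le> j" "j \<le> N"
  shows "block A (w i) = block A (w j) \<and> block B i = block B j \<longleftrightarrow>
    block (stab_meet A B w) i = block (stab_meet A B w) j"
proof
  have wp: "w permutes {1..N}" using w by (simp add: double_perms_def)
  have w1: "1 \<le> w k" if "1 \<le> k" "k \<le> N" for k
    using permutes_in_image[OF wp, of k] that by simp
  {
    assume L: "block A (w i) = block A (w j) \<and> block B i = block B j"
    then have B: "{i..<j} \<subseteq> B" using block_eq_iff[OF ij(1,2)] by blast
    have mono: "w k < w l" if "i \<le> k" "k < l" "l \<le> j" for k l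
    proof (rule double_perm_increasing[OF w])
      show "1 \<le> k" "k < l" using that ij by auto
      have "{k..<l} \<subseteq> {i..<j}" using that by auto
      then have "{k..<l} \<subseteq> B" using B by (rule subset_trans)
      then show "block B k = block B l"
        using \<open>1 \<le> k\<close> \<open>k < l\<close> block_eq_iff[of k l B] by simp
    qed
    have mono_le: "w k \<le> w l" if "i \<le> k" "k \<le> l" "l \<le> j" for k l
      using mono[of k l] that by (cases "k = l") (auto intro: less_imp_le)
    have wij: "w i \<le> w j" using mono_le[of i j] ij by simp
    then have A: "{w i..<w j} \<subseteq> A" using block_eq_iff[of "w i" "w j" A] L w1[of i] ij by simp
    have "k \<in> stab_meet A B w" if k: "k \<in> {i..<j}" for k
    proof -
      have lt: "w k < w (Suc k)" using mono[of k "Suc k"] k by simp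
      have between: "w i \<le> w k" "w (Suc k) \<le> w j" using mono_le[of i k] mono_le[of "Suc k" j] k by auto
      have wkA: "w k \<in> A" using A between lt by auto
      have "w (Suc k) = Suc (w k)"
      proof (rule ccontr)
        assume "w (Suc k) \<noteq> Suc (w k)"
        then have lt': "Suc (w k) < w (Suc k)" using lt by simp
        define l where "l = inv_into UNIV w (Suc (w k))"
        have wl: "w l = Suc (w k)" unfolding l_def by (rule permutes_inverses(1)[OF wp])
        have "w (Suc k) \<in> {1..N}" using permutes_in_image[OF wp, of "Suc k"] k ij by auto
        then have "w l \<in> {1..N}" using wl lt' by auto
        then have l: "l \<in> {1..N}" using permutes_in_image[OF wp] by blast
        have inc: "\<forall>a\<in>A. inv_into UNIV w a < inv_into UNIV w (Suc a)"
          using w by (simp add: double_perms_def)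
        have e: "block A (w k) = block A x" if "w k \<le> x" "x \<le> w (Suc k)" for x
        proof -
          have "{w k..<x} \<subseteq> {w i..<w j}" using that between by auto
          then show ?thesis using block_eq_iff[of "w k" x A] A that w1[of k] k ij by auto
        qed
        \<comment> \<open>A value strictly between \<open>w k\<close> and \<open>w (Suc k)\<close> would have its preimage between \<open>k\<close> and \<open>Suc k\<close>.\<close>
        have "k < l"
          by (rule inv_less_in_block[OF wp inc]) (use k ij wl lt' e[of "w l"] in auto)
        moreover have "l < Suc k"
          by (rule inv_less_in_block[OF wp inc l])
            (use wl lt' e[of "w l"] e[of "w (Suc k)"] in auto)
        ultimately show False by simp
      qed
      then show ?thesis using B k wkA by (auto simp: stab_meet_def)
    qed
    then show "block (stab_meet A B w) i = block (stab_meet A B w) j"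
      using block_eq_iff[OF ij(1,2)] by blast
  }
  {
    assume "block (stab_meet A B w) i = block (stab_meet A B w) j"
    then have sub: "{i..<j} \<subseteq> stab_meet A B w" using block_eq_iff[OF ij(1,2)] by blast
    have step: "block A (w k) = block A (w (Suc k))" if "k \<in> {i..<j}" for k
    proof -
      have "w k \<in> A" "w (Suc k) = Suc (w k)" using sub that by (auto simp: stab_meet_def)
      moreover have "1 \<le> w k" using w1[of k] that ij by simp
      ultimately show ?thesis using block_Suc_eq_iff[of "w k" A] by simp
    qed
    have "block A (w i) = block A (w j)"
      using ij(2) step
    proof (induction rule: dec_induct)
      case (step m)
      then have "block A (w i) = block A (w m)" by simp
      also have "\<dots> = block A (w (Suc m))" using step by simp
      finally show ?case .
    qed simp
    moreover have "block B i = block B j"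
      using block_eq_iff[OF ij(1,2), of B] sub by (auto simp: stab_meet_def)
    ultimately show "block A (w i) = block A (w j) \<and> block B i = block B j" ..
  }
qed

lemma stab_meet_kernel:
  assumes w: "w \<in> double_perms N A B" and "i \<in> {1..N}" "j \<in> {1..N}"
  shows "block A (w i) = block A (w j) \<and> block B i = block B j \<longleftrightarrow>
    block (stab_meet A B w) i = block (stab_meet A B w) j"
proof (cases "i \<le> j")
  case True
  then show ?thesis using stab_meet_kernel_le[OF w, of i j] assms by simp
next
  case False
  then show ?thesis using stab_meet_kernel_le[OF w, of j i] assms by auto
qed

lemma double_perm_block_mono:
  assumes w: "w \<in> double_perms N A B" and ij: "1 \<le> i" "i \<le> j" and eq: "block B i = block B j"
  shows "block A (w i) \<le> block A (w j)"
  using double_perm_increasing[OF w ij(1) _ eq] ij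
  by (cases "i = j") (auto intro!: block_mono)

text \<open>The lexicographic order on pairs whose second entry is at most \<open>N\<close>, coded by numbers so that
  standardization applies to words in pairs.\<close>

definition lex_code :: "nat \<Rightarrow> nat \<Rightarrow> nat \<Rightarrow> nat" where
  "lex_code N a b = a * Suc N + b"

lemma lex_code_less:
  assumes "a < c" "b \<le> N"
  shows "lex_code N a b < lex_code N c d"
proof -
  have "a * Suc N + b < Suc a * Suc N" using assms(2) by simp
  also have "\<dots> \<le> c * Suc N" using assms(1) by (intro mult_le_mono1) simp
  finally show ?thesis by (simp only: lex_code_def trans_less_add1)
qed

lemma lex_code_le_iff:
  assumes "b \<le> N" "d \<le> N"
  shows "lex_code N a b \<le> lex_code N c d \<longleftrightarrow> a < c \<or> a = c \<and> b \<le> d"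
proof (cases a c rule: linorder_cases)
  case less
  then show ?thesis using lex_code_less[OF less assms(1), of d] by simp
next
  case equal
  then show ?thesis by (simp add: lex_code_def)
next
  case greater
  then show ?thesis using lex_code_less[OF greater assms(2), of b] by simp
qed

lemma lex_code_eq_iff:
  assumes "b \<le> N" "d \<le> N"
  shows "lex_code N a b = lex_code N c d \<longleftrightarrow> a = c \<and> b = d"
  using lex_code_le_iff[OF assms, of a c] lex_code_le_iff[OF assms(2,1), of c a] by force

lemma block_perm_le: "w permutes {1..N} \<Longrightarrow> i \<in> {1..N} \<Longrightarrow> block A (w i) \<le> N"
  using permutes_in_image[of w "{1..N}" i] by (intro block_le) simp

text \<open>Different representatives give disjoint orbits of pairs: if two pairs of words have a common
  rearrangement, both are its lexicographically sorted form, so the words \<open>block A \<circ> w\<close> and \<open>block A \<circ> w'\<close>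
  agree and \<open>w\<close> is their standardization.\<close>

lemma double_perm_unique:
  assumes w: "w \<in> double_perms N A B" and w': "w' \<in> double_perms N A B"
    and s: "s permutes {1..N}" and s': "s' permutes {1..N}"
    and A: "\<And>i. i \<in> {1..N} \<Longrightarrow> block A (w (s i)) = block A (w' (s' i))"
    and B: "\<And>i. i \<in> {1..N} \<Longrightarrow> block B (s i) = block B (s' i)"
  shows "w = w'"
proof -
  have wp: "w permutes {1..N}" "w' permutes {1..N}" using w w' by (simp_all add: double_perms_def)
  define t where "t = s \<circ> inv_into UNIV s'"
  have t: "t permutes {1..N}"
    unfolding t_def using permutes_compose[OF permutes_inv[OF s'] s] .
  define c where "c v i = lex_code N (block B i) (block A (v i))" for v :: "nat \<Rightarrow> nat" and i
  have mono: "c v i \<le> c v j"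
    if v: "v \<in> double_perms N A B" and ij: "1 \<le> i" "i \<le> j" "j \<le> N" for v i j
  proof -
    have vp: "v permutes {1..N}" using v by (simp add: double_perms_def)
    have le: "block A (v i) \<le> N" "block A (v j) \<le> N" using block_perm_le[OF vp] ij by auto
    show ?thesis unfolding c_def lex_code_le_iff[OF le]
      using block_mono[OF ij(2), of B] double_perm_block_mono[OF v ij(1,2)] by linarith
  qed
  have eq: "c w' i = c w (t i)" if i: "i \<in> {1..N}" for i
  proof -
    define k where "k = inv_into UNIV s' i"
    have k: "s' k = i" "s k = t i" by (simp_all add: k_def t_def permutes_inverses(1)[OF s'])
    then have "k \<in> {1..N}" using i permutes_in_image[OF s', of k] by simp
    then show ?thesis using A[of k] B[of k] by (simp add: c_def k)
  qed
  have "block A (w i) = block A (w' i)" if i: "i \<in> {1..N}" for i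
  proof -
    have "c w i = c w' i"
      by (rule mono_rearrangement_eq[where u = "c w" and v = "c w'", OF t mono[OF w] mono[OF w'] eq i])
    then show ?thesis unfolding c_def
      using lex_code_eq_iff[OF block_perm_le[OF wp(1) i] block_perm_le[OF wp(2) i]] by blast
  qed
  then have "standardize N (block A \<circ> w) = standardize N (block A \<circ> w')"
    by (auto simp: standardize_def fun_eq_iff intro!: arg_cong[where f = card])
  then show ?thesis using double_perm_eq_standardize[OF w] double_perm_eq_standardize[OF w'] by simp
qed

text \<open>Sorting a rearrangement of an increasing word gives back this word, so a rearrangement \<open>f\<close> of \<open>block A\<close> is
  reached from \<open>block A\<close> by the standardization of \<open>f\<close>.\<close>

lemma block_standardize:
  assumes s: "s permutes {1..N}" and f: "\<And>i. i \<in> {1..N} \<Longrightarrow> f i = block A (s i)"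
    and i: "i \<in> {1..N}"
  shows "block A (standardize N f i) = f i"
proof -
  let ?p = "inv_into UNIV (standardize N f)"
  have p: "?p permutes {1..N}" by (rule permutes_inv[OF standardize_permutes])
  have inv: "standardize N f (?p x) = x" "?p (standardize N f x) = x" for x
    using permutes_inverses[OF standardize_permutes] by auto
  have in_img: "?p x \<in> {1..N}" if "x \<in> {1..N}" for x using permutes_in_image[OF p] that by blast
  have mono: "f (?p x) \<le> f (?p y)" if xy: "1 \<le> x" "x \<le> y" "y \<le> N" for x y
  proof (rule ccontr)
    assume "\<not> f (?p x) \<le> f (?p y)"
    moreover have "?p x \<in> {1..N}" "?p y \<in> {1..N}" using in_img xy by auto
    ultimately have "standardize N f (?p y) < standardize N f (?p x)" by (intro standardize_less) auto
    then show False using xy by (simp add: inv)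
  qed
  have "block A x = f (?p x)" if "x \<in> {1..N}" for x
  proof (rule mono_rearrangement_eq[where u = "block A" and t = "s \<circ> ?p", OF _ _ mono _ that])
    show "(s \<circ> ?p) permutes {1..N}" using permutes_compose[OF p s] .
    show "f (?p i) = block A ((s \<circ> ?p) i)" if "i \<in> {1..N}" for i
      using f[OF in_img[OF that]] by simp
  qed (auto intro: block_mono)
  from this[of "standardize N f i"] show ?thesis
    using i permutes_in_image[OF standardize_permutes, of N f i] by (simp add: inv)
qed

text \<open>Every pair of rearrangements lies in the orbit of some representative. Sort the word of pairs, with the
  \<open>B\<close>-letter first, by \<open>t\<close>. The \<open>B\<close>-component becomes \<open>block B\<close>, and the \<open>A\<close>-component becomes a word \<open>f\<close>
  that is weakly increasing on the blocks of \<open>B\<close>. Then \<open>w = standardize N f\<close> is increasing on these blocks,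
  and its inverse is increasing on the blocks of \<open>A\<close> because standardization keeps the order of equal letters.\<close>

lemma double_perm_exists:
  assumes A: "A \<subseteq> {1..<N}" and B: "B \<subseteq> {1..<N}"
    and s: "s permutes {1..N}" and s': "s' permutes {1..N}"
  shows "\<exists>w\<in>double_perms N A B. \<exists>t. t permutes {1..N} \<and>
    (\<forall>i\<in>{1..N}. block A (w (t i)) = block A (s i) \<and> block B (t i) = block B (s' i))"
proof -
  define g where "g i = lex_code N (block B (s' i)) (block A (s i))" for i
  define t where "t = standardize N g"
  have t: "t permutes {1..N}" unfolding t_def by (rule standardize_permutes)
  let ?r = "inv_into UNIV t"
  have r: "?r permutes {1..N}" by (rule permutes_inv[OF t])
  have inv: "t (?r x) = x" "?r (t x) = x" for x using permutes_inverses[OF t] by auto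
  have in_img: "?r x \<in> {1..N}" if "x \<in> {1..N}" for x using permutes_in_image[OF r] that by blast
  have g_mono: "g (?r x) \<le> g (?r y)" if xy: "1 \<le> x" "x \<le> y" "y \<le> N" for x y
  proof (rule ccontr)
    assume "\<not> g (?r x) \<le> g (?r y)"
    moreover have "?r x \<in> {1..N}" "?r y \<in> {1..N}" using in_img xy by auto
    ultimately have "t (?r y) < t (?r x)" unfolding t_def by (intro standardize_less) auto
    then show False using xy by (simp add: inv)
  qed
  have lex: "block B (s' (?r x)) < block B (s' (?r y)) \<or>
      block B (s' (?r x)) = block B (s' (?r y)) \<and> block A (s (?r x)) \<le> block A (s (?r y))"
    if xy: "1 \<le> x" "x \<le> y" "y \<le> N" for x y
  proof -
    have "?r x \<in> {1..N}" "?r y \<in> {1..N}" using in_img xy by auto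
    then show ?thesis using g_mono[OF xy] unfolding g_def
      using lex_code_le_iff[OF block_perm_le[OF s] block_perm_le[OF s]] by blast
  qed
  have tB: "block B x = block B (s' (?r x))" if "x \<in> {1..N}" for x
  proof (rule mono_rearrangement_eq[where t = "s' \<circ> ?r", OF _ _ _ _ that])
    show "(s' \<circ> ?r) permutes {1..N}" using permutes_compose[OF r s'] .
    show "block B (s' (?r i)) \<le> block B (s' (?r j))" if "1 \<le> i" "i \<le> j" "j \<le> N" for i j
      using lex[OF that] by auto
  qed (auto intro: block_mono)
  define f where "f x = block A (s (?r x))" for x
  define w where "w = standardize N f"
  have wp: "w permutes {1..N}" unfolding w_def by (rule standardize_permutes)
  have w_f: "block A (w x) = f x" if "x \<in> {1..N}" for x
    unfolding w_def
    by (rule block_standardize[where s = "s \<circ> ?r", OF permutes_compose[OF r s] _ that]) (simp add: f_def)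
  have "w \<in> double_perms N A B"
  proof -
    have "w b < w (Suc b)" if "b \<in> B" for b
    proof -
      have b: "1 \<le> b" "b \<in> {1..N}" "Suc b \<in> {1..N}" using that B by auto
      have "block B (s' (?r b)) = block B (s' (?r (Suc b)))"
        using tB[OF b(2)] tB[OF b(3)] block_Suc_eq_iff[OF b(1), of B] that by simp
      then have "f b \<le> f (Suc b)" using lex[of b "Suc b"] b unfolding f_def by auto
      then show ?thesis unfolding w_def using b by (intro standardize_less) auto
    qed
    moreover have "inv_into UNIV w a < inv_into UNIV w (Suc a)" if "a \<in> A" for a
    proof (rule ccontr)
      let ?i = "inv_into UNIV w a" and ?j = "inv_into UNIV w (Suc a)"
      assume "\<not> ?i < ?j"
      moreover have wi: "w ?i = a" "w ?j = Suc a" using permutes_inverses(1)[OF wp] by auto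
      moreover from wi have "?i \<noteq> ?j" by auto
      ultimately have "?j < ?i" by simp
      have a: "1 \<le> a" "a \<in> {1..N}" "Suc a \<in> {1..N}" using that A by auto
      have ij: "?i \<in> {1..N}" "?j \<in> {1..N}"
        using a permutes_in_image[OF permutes_inv[OF wp]] by blast+
      have "f ?i = f ?j"
        using w_f[OF ij(1)] w_f[OF ij(2)] block_Suc_eq_iff[OF a(1), of A] that wi by simp
      then have "standardize N f ?j < standardize N f ?i"
        using \<open>?j < ?i\<close> by (intro standardize_less[OF ij(2,1)]) simp
      then have "w ?j < w ?i" by (simp only: w_def)
      then show False using wi by simp
    qed
    ultimately show ?thesis using wp by (simp add: double_perms_def)
  qed
  moreover have "block A (w (t i)) = block A (s i)" "block B (t i) = block B (s' i)"
    if "i \<in> {1..N}" for i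
  proof -
    have "t i \<in> {1..N}" using permutes_in_image[OF t] that by blast
    from w_f[OF this] tB[OF this]
    show "block A (w (t i)) = block A (s i)" "block B (t i) = block B (s' i)"
      by (simp_all add: f_def inv)
  qed
  ultimately show ?thesis using t by blast
qed

lemma finite_double_perms: "finite (double_perms N A B)"
  by (rule finite_subset[OF _ finite_permutations[of "{1..N}"]]) (auto simp: double_perms_def)

lemma arrangementsI:
  assumes "s permutes {1..N}" "\<And>i. i \<in> {1..N} \<Longrightarrow> h i = p (s i)" "h \<in> extensional {1..N}"
    "M \<subseteq> {1..<N}" "\<And>m. m \<in> M \<Longrightarrow> h m = h (Suc m)"
  shows "h \<in> arrangements N p M"
proof -
  have "p (s m) = p (s (Suc m))" if "m \<in> M" for m
  proof -
    have "m \<in> {1..N}" "Suc m \<in> {1..N}" using that assms(4) by auto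
    then show ?thesis using assms(2)[of m] assms(2)[of "Suc m"] assms(5)[OF that] by simp
  qed
  moreover have "h = restrict (p \<circ> s) {1..N}"
    using assms(2,3) by (auto simp: fun_eq_iff restrict_def extensional_def)
  ultimately show ?thesis using assms(1) unfolding arrangements_def by blast
qed

lemma arrangementsE:
  assumes "h \<in> arrangements N p M" "M \<subseteq> {1..<N}"
  obtains s where "s permutes {1..N}" "\<And>i. i \<in> {1..N} \<Longrightarrow> h i = p (s i)" "h \<in> extensional {1..N}"
    "\<And>m. m \<in> M \<Longrightarrow> h m = h (Suc m)"
proof -
  obtain s where s: "s permutes {1..N}" "h = restrict (p \<circ> s) {1..N}"
          "\<forall>m\<in>M. p (s m) = p (s (Suc m))"
    using assms(1) by (auto simp: arrangements_def)
  show thesis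
  proof (rule that[OF s(1)])
    show "h m = h (Suc m)" if "m \<in> M" for m
    proof -
      have "m \<in> {1..N}" "Suc m \<in> {1..N}" using that assms(2) by auto
      then show ?thesis using s(2,3) that by simp
    qed
  qed (auto simp: s(2))
qed

text \<open>Mackey's formula for the permutation modules \<open>W/W\<^sub>A\<close>: the fixed points in a product of two orbits are
  counted orbit by orbit, and the orbit of the pair belonging to \<open>w\<close> is a copy of \<open>W/W\<^sub>L\<close> with
  \<open>L = stab_meet A B w\<close>.\<close>

theorem marks_mult:
  assumes A: "A \<subseteq> {1..<N}" and B: "B \<subseteq> {1..<N}" and M: "M \<subseteq> {1..<N}"
  shows "marks N A M * marks N B M = (\<Sum>w\<in>double_perms N A B. marks N (stab_meet A B w) M)"
proof -
  define pr where "pr w i = (block A (w i), block B i)" for w i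
  define zip' where "zip' h = (\<lambda>i\<in>{1..N}. (fst h i :: nat, snd h i :: nat))"
    for h :: "(nat \<Rightarrow> nat) \<times> (nat \<Rightarrow> nat)"
  let ?P = "arrangements N (block A) M \<times> arrangements N (block B) M"
  have inj: "inj_on zip' ?P"
  proof (rule inj_onI)
    fix x y assume x: "x \<in> ?P" and y: "y \<in> ?P" and eq: "zip' x = zip' y"
    have "fst x i = fst y i \<and> snd x i = snd y i" if "i \<in> {1..N}" for i
      using fun_cong[OF eq, of i] that by (simp add: zip'_def)
    moreover have "fst x \<in> extensional {1..N}" "snd x \<in> extensional {1..N}"
      "fst y \<in> extensional {1..N}" "snd y \<in> extensional {1..N}"
      using x y by (auto simp: arrangements_def)
    ultimately show "x = y" by (auto intro!: prod_eqI extensionalityI)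
  qed
  have img: "zip' ` ?P = (\<Union>w\<in>double_perms N A B. arrangements N (pr w) M)"
  proof (intro subset_antisym subsetI)
    fix h assume "h \<in> zip' ` ?P"
    then obtain u v where h: "h = zip' (u, v)"
      and u: "u \<in> arrangements N (block A) M" and v: "v \<in> arrangements N (block B) M" by auto
    obtain s where s: "s permutes {1..N}" "\<And>i. i \<in> {1..N} \<Longrightarrow> u i = block A (s i)"
        "\<And>m. m \<in> M \<Longrightarrow> u m = u (Suc m)"
      using arrangementsE[OF u M] by metis
    obtain s' where s': "s' permutes {1..N}" "\<And>i. i \<in> {1..N} \<Longrightarrow> v i = block B (s' i)"
        "\<And>m. m \<in> M \<Longrightarrow> v m = v (Suc m)"
      using arrangementsE[OF v M] by metis
    obtain w t where w: "w \<in> double_perms N A B" and t: "t permutes {1..N}"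
      and wt: "\<And>i. i \<in> {1..N} \<Longrightarrow> block A (w (t i)) = block A (s i)"
        "\<And>i. i \<in> {1..N} \<Longrightarrow> block B (t i) = block B (s' i)"
      using double_perm_exists[OF A B s(1) s'(1)] by blast
    have "h \<in> arrangements N (pr w) M"
    proof (rule arrangementsI[OF t _ _ M])
      show "h i = pr w (t i)" if "i \<in> {1..N}" for i
        using that s(2) s'(2) wt by (simp add: h zip'_def pr_def)
      show "h m = h (Suc m)" if "m \<in> M" for m
      proof -
        have "m \<in> {1..N}" "Suc m \<in> {1..N}" using that M by auto
        then show ?thesis using s(3)[OF that] s'(3)[OF that] by (simp add: h zip'_def)
      qed
    qed (simp add: h zip'_def)
    then show "h \<in> (\<Union>w\<in>double_perms N A B. arrangements N (pr w) M)" using w by blast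
  next
    fix h assume "h \<in> (\<Union>w\<in>double_perms N A B. arrangements N (pr w) M)"
    then obtain w where w: "w \<in> double_perms N A B" and hw: "h \<in> arrangements N (pr w) M" by blast
    have wp: "w permutes {1..N}" using w by (simp add: double_perms_def)
    obtain s where s: "s permutes {1..N}" "\<And>i. i \<in> {1..N} \<Longrightarrow> h i = pr w (s i)"
        "h \<in> extensional {1..N}" "\<And>m. m \<in> M \<Longrightarrow> h m = h (Suc m)"
      using arrangementsE[OF hw M] by metis
    define u where "u = restrict (fst \<circ> h) {1..N}"
    define v where "v = restrict (snd \<circ> h) {1..N}"
    have mM: "u m = u (Suc m)" "v m = v (Suc m)" if "m \<in> M" for m
    proof -
      have "m \<in> {1..N}" "Suc m \<in> {1..N}" using that M by auto
      then show "u m = u (Suc m)" "v m = v (Suc m)" using s(4)[OF that] by (simp_all add: u_def v_def)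
    qed
    have "u \<in> arrangements N (block A) M"
      by (rule arrangementsI[where h = u and p = "block A", OF permutes_compose[OF s(1) wp] _ _ M mM(1)])
        (simp_all add: u_def s(2) pr_def)
    moreover have "v \<in> arrangements N (block B) M"
      by (rule arrangementsI[where h = v and p = "block B", OF s(1) _ _ M mM(2)]) (simp_all add: v_def s(2) pr_def)
    moreover have "h = zip' (u, v)"
      using s(3) by (auto simp: zip'_def u_def v_def fun_eq_iff extensional_def)
    ultimately show "h \<in> zip' ` ?P" by blast
  qed
  have "marks N A M * marks N B M = card (zip' ` ?P)"
    using card_image[OF inj] by (simp add: marks_def card_cartesian_product)
  also have "\<dots> = (\<Sum>w\<in>double_perms N A B. card (arrangements N (pr w) M))"
    unfolding img
  proof (rule card_UN_disjoint)
    show "\<forall>w\<in>double_perms N A B. \<forall>w'\<in>double_perms N A B. w \<noteq> w' \<longrightarrow>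
        arrangements N (pr w) M \<inter> arrangements N (pr w') M = {}"
    proof (intro ballI impI equals0I)
      fix w w' h assume w: "w \<in> double_perms N A B" and w': "w' \<in> double_perms N A B"
        and neq: "w \<noteq> w'" and h: "h \<in> arrangements N (pr w) M \<inter> arrangements N (pr w') M"
      obtain s where s: "s permutes {1..N}" "\<And>i. i \<in> {1..N} \<Longrightarrow> h i = pr w (s i)"
        using arrangementsE[OF IntD1[OF h] M] by metis
      obtain s' where s': "s' permutes {1..N}" "\<And>i. i \<in> {1..N} \<Longrightarrow> h i = pr w' (s' i)"
        using arrangementsE[OF IntD2[OF h] M] by metis
      have "w = w'"
        by (rule double_perm_unique[OF w w' s(1) s'(1)])
          (use s(2) s'(2) in \<open>auto simp: pr_def\<close>)
      then show False using neq by simp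
    qed
  qed (simp_all add: finite_double_perms finite_arrangements)
  also have "\<dots> = (\<Sum>w\<in>double_perms N A B. marks N (stab_meet A B w) M)"
    unfolding marks_def
  proof (rule sum.cong[OF refl], rule card_arrangements_cong[OF _ M])
    fix w i j assume "w \<in> double_perms N A B" "i \<in> {1..N}" "j \<in> {1..N}"
    from stab_meet_kernel[OF this]
    show "pr w i = pr w j \<longleftrightarrow> block (stab_meet A B w) i = block (stab_meet A B w) j"
      by (simp add: pr_def)
  qed
  finally show ?thesis .
qed

lemma marks_full:
  assumes M: "M \<subseteq> {1..<N}"
  shows "marks N {1..<N} M = 1"
proof -
  have b: "block {1..<N} i = 0" if "i \<in> {1..N}" for i
    using that by (auto simp: block_def)
  have "arrangements N (block {1..<N}) M = {restrict (\<lambda>_. 0) {1..N}}"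
  proof (intro subset_antisym subsetI)
    fix h assume "h \<in> arrangements N (block {1..<N}) M"
    then obtain s where s: "s permutes {1..N}" "\<And>i. i \<in> {1..N} \<Longrightarrow> h i = block {1..<N} (s i)"
        "h \<in> extensional {1..N}"
      using arrangementsE[OF _ M] by metis
    have "h = restrict (\<lambda>_. 0) {1..N}"
    proof (rule extensionalityI[OF s(3)])
      fix i assume i: "i \<in> {1..N}"
      then have "s i \<in> {1..N}" using permutes_in_image[OF s(1)] by blast
      then show "h i = restrict (\<lambda>_. 0) {1..N} i" using s(2)[OF i] b i by simp
    qed simp
    then show "h \<in> {restrict (\<lambda>_. 0) {1..N}}" by simp
  next
    fix h assume "h \<in> {restrict (\<lambda>_. 0 :: nat) {1..N}}"
    moreover have "m \<in> {1..N} \<and> Suc m \<in> {1..N}" if "m \<in> M" for m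
      using that M by auto
    ultimately show "h \<in> arrangements N (block {1..<N}) M"
      using b by (intro arrangementsI[OF permutes_id _ _ M]) simp_all
  qed
  then show ?thesis by (simp add: marks_def)
qed

section \<open>Marks separate conjugacy classes\<close>

lemma adjacent_hom_block:
  assumes A: "A \<subseteq> {1..<N}" and w: "w permutes {1..N}"
    and hom: "\<And>a. a \<in> A \<Longrightarrow> w a \<in> B \<and> w (Suc a) = Suc (w a)"
    and i: "i \<in> {1..N}" and j: "j \<in> {1..N}" and eq: "block A i = block A j"
  shows "block B (w i) = block B (w j)"
proof -
  have le: "block B (w k) = block B (w l)"
    if kl: "1 \<le> k" "k \<le> l" and eq: "block A k = block A l" for k l
  proof -
    have sub: "{k..<l} \<subseteq> A" using block_eq_iff[OF kl] eq by blast
    have "block B (w m) = block B (w (Suc m))" if "m \<in> {k..<l}" for m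
    proof -
      have m: "m \<in> A" using sub that by blast
      then have "m \<in> {1..N}" using A by auto
      then have "1 \<le> w m" using permutes_in_image[OF w, of m] by simp
      then show ?thesis using hom[OF m] block_Suc_eq_iff[of "w m" B] by simp
    qed
    with kl(2) show ?thesis
    proof (induction rule: dec_induct)
      case (step m)
      then have "block B (w k) = block B (w m)" by simp
      also have "\<dots> = block B (w (Suc m))" using step by simp
      finally show ?case .
    qed simp
  qed
  show ?thesis
  proof (cases "i \<le> j")
    case True
    show ?thesis by (rule le[OF _ True eq]) (use i in simp)
  next
    case False
    then have "j \<le> i" by simp
    have "block B (w j) = block B (w i)"
      by (rule le[OF _ \<open>j \<le> i\<close> eq[symmetric]]) (use j in simp)
    then show ?thesis ..
  qed
qed

lemma marks_conj:
  assumes A: "A \<subseteq> {1..<N}" and B: "B \<subseteq> {1..<N}" and M: "M \<subseteq> {1..<N}"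
    and w: "w permutes {1..N}"
    and hom: "\<And>a. a \<in> A \<Longrightarrow> w a \<in> B \<and> w (Suc a) = Suc (w a)"
    and onto: "B \<subseteq> w ` A"
  shows "marks N A M = marks N B M"
proof -
  let ?v = "inv_into UNIV w"
  have v: "?v permutes {1..N}" by (rule permutes_inv[OF w])
  have inv: "?v (w x) = x" "w (?v x) = x" for x using permutes_inverses[OF w] by auto
  have hom': "?v b \<in> A \<and> ?v (Suc b) = Suc (?v b)" if b: "b \<in> B" for b
  proof -
    obtain a where a: "a \<in> A" "b = w a" using b onto by blast
    then have "Suc b = w (Suc a)" using hom by simp
    then show ?thesis using a inv(1) by metis
  qed
  have "card (arrangements N (block A) M) = card (arrangements N (block B \<circ> w) M)"
  proof (rule card_arrangements_cong[OF _ M])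
    fix i j assume ij: "i \<in> {1..N}" "j \<in> {1..N}"
    then have wij: "w i \<in> {1..N}" "w j \<in> {1..N}" using permutes_in_image[OF w] by blast+
    show "block A i = block A j \<longleftrightarrow> (block B \<circ> w) i = (block B \<circ> w) j"
      using adjacent_hom_block[OF A w hom ij] adjacent_hom_block[OF B v hom' wij]
      by (auto simp: inv)
  qed
  then show ?thesis by (simp add: marks_def arrangements_comp[OF w])
qed

lemma marks_self:
  assumes "A \<subseteq> {1..<N}"
  shows "marks N A A \<noteq> 0"
proof -
  have "restrict (block A) {1..N} \<in> arrangements N (block A) A"
  proof (rule arrangementsI[OF permutes_id _ _ assms])
    fix m assume m: "m \<in> A"
    then have "m \<in> {1..N}" "Suc m \<in> {1..N}" using assms by auto
    then show "restrict (block A) {1..N} m = restrict (block A) {1..N} (Suc m)"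
      using m block_Suc_eq_iff[of m A] by simp
  qed simp_all
  then show ?thesis
    unfolding marks_def using finite_arrangements[of N "block A" A] card_0_eq by blast
qed

text \<open>Triangularity of the table of marks. A fixed point is a rearrangement of \<open>block A\<close> that is constant on the blocks of
  \<open>B\<close>. Its standardization numbers the positions of equal letters consecutively and in
  order; hence it moves the adjacent positions \<open>b, Suc b\<close> to adjacent positions inside one block of \<open>A\<close>.\<close>

lemma marks_nonzero_embedding:
  assumes A: "A \<subseteq> {1..<N}" and B: "B \<subseteq> {1..<N}" and nz: "marks N A B \<noteq> 0"
  shows "\<exists>w. w permutes {1..N} \<and> (\<forall>b\<in>B. w b \<in> A \<and> w (Suc b) = Suc (w b))"
proof -
  obtain f where f: "f \<in> arrangements N (block A) B"
    using nz unfolding marks_def by fastforce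
  obtain s where s: "s permutes {1..N}" "\<And>i. i \<in> {1..N} \<Longrightarrow> f i = block A (s i)"
      "\<And>b. b \<in> B \<Longrightarrow> f b = f (Suc b)"
    using arrangementsE[OF f B] by metis
  define w where "w = standardize N f"
  have w: "w permutes {1..N}" unfolding w_def by (rule standardize_permutes)
  have wf: "block A (w i) = f i" if "i \<in> {1..N}" for i
    unfolding w_def by (rule block_standardize[OF s(1,2) that])
  have "w b \<in> A \<and> w (Suc b) = Suc (w b)" if b: "b \<in> B" for b
  proof -
    have bN: "b \<in> {1..N}" "Suc b \<in> {1..N}" using b B by auto
    have wb: "w b \<in> {1..N}" "w (Suc b) \<in> {1..N}" using bN permutes_in_image[OF w] by blast+
    have lt: "w b < w (Suc b)" unfolding w_def using s(3)[OF b] by (intro standardize_less[OF bN]) simp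
    have "block A (w b) = block A (w (Suc b))" using wf bN s(3)[OF b] by simp
    then have sub: "{w b..<w (Suc b)} \<subseteq> A" using block_eq_iff[of "w b" "w (Suc b)" A] wb lt by simp
    have "w (Suc b) = Suc (w b)"
    proof (rule ccontr)
      assume "w (Suc b) \<noteq> Suc (w b)"
      then have lt': "Suc (w b) < w (Suc b)" using lt by simp
      define k where "k = inv_into UNIV w (Suc (w b))"
      have wk: "w k = Suc (w b)" unfolding k_def by (rule permutes_inverses(1)[OF w])
      have "w k \<in> {1..N}" using wk lt' wb by auto
      then have k: "k \<in> {1..N}" using permutes_in_image[OF w] by blast
      have "block A (w b) = block A (w k)"
        using block_Suc_eq_iff[of "w b" A] wb sub lt wk by auto
      then have fk: "f k = f b" using wf bN k by simp
      have "b < k"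
        using standardize_less_iff[OF bN(1) k, of f] wk fk unfolding w_def by simp
      moreover have "k < Suc b"
        using standardize_less_iff[OF k bN(2), of f] wk lt' fk s(3)[OF b] unfolding w_def by simp
      ultimately show False by simp
    qed
    then show ?thesis using sub lt by auto
  qed
  then show ?thesis using w by blast
qed

section \<open>The Weyl group as a permutation group\<close>

locale type_A =
  fixes n :: nat and e :: "nat \<Rightarrow> 'a::euclidean_space"
  assumes dim: "DIM('a) = n + 1"
    and orthonormal: "\<And>i j. i \<in> {1..n+1} \<Longrightarrow> j \<in> {1..n+1} \<Longrightarrow> e i \<bullet> e j = (if i = j then 1 else 0)"
begin

abbreviation "I \<equiv> {1..n+1}"

definition simple :: "nat \<Rightarrow> 'a" where
  "simple i = e i - e (Suc i)"

definition perm_map :: "(nat \<Rightarrow> nat) \<Rightarrow> 'a \<Rightarrow> 'a" where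
  "perm_map p v = (\<Sum>i\<in>I. (v \<bullet> e i) *\<^sub>R e (p i))"

lemma inner_basis_sum: "j \<in> I \<Longrightarrow> (\<Sum>i\<in>I. c i *\<^sub>R e i) \<bullet> e j = c j"
proof -
  assume j: "j \<in> I"
  have "(\<Sum>i\<in>I. c i *\<^sub>R e i) \<bullet> e j = (\<Sum>i\<in>I. if i = j then c i else 0)"
    unfolding inner_sum_left by (rule sum.cong[OF refl]) (use j in \<open>simp only: inner_scaleR_left orthonormal split: if_splits\<close>, simp)
  also have "\<dots> = c j" using j by (simp only: sum.delta finite_atLeastAtMost if_True)
  finally show ?thesis .
qed

text \<open>This is where the dimension enters: \<open>n + 1\<close> orthonormal vectors span the whole space. Hence an element of
  \<open>W\<close>, a function on the whole space, is known from its values on the vectors \<open>e i\<close>.\<close>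

lemma span_basis: "span (e ` I) = UNIV"
proof -
  have inj: "inj_on e I"
    by (rule inj_onI) (metis orthonormal zero_neq_one)
  have "pairwise orthogonal (e ` I)"
    using orthonormal by (auto simp: pairwise_def orthogonal_def)
  moreover have "0 \<notin> e ` I"
    using orthonormal by (metis imageE inner_zero_left zero_neq_one)
  ultimately have "independent (e ` I)" by (rule pairwise_orthogonal_independent)
  moreover have "card (e ` I) = DIM('a)" using card_image[OF inj] dim by simp
  ultimately show ?thesis
    using card_ge_dim_independent[of "e ` I" UNIV] by (simp add: dim_UNIV top.extremum_unique)
qed

lemma expand: "v = (\<Sum>i\<in>I. (v \<bullet> e i) *\<^sub>R e i)"
proof -
  let ?x = "v - (\<Sum>i\<in>I. (v \<bullet> e i) *\<^sub>R e i)"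
  have "orthogonal ?x ?x"
  proof (rule orthogonal_to_span)
    show "?x \<in> span (e ` I)" unfolding span_basis by (rule UNIV_I)
    fix y assume "y \<in> e ` I"
    then obtain i where "i \<in> I" "y = e i" by blast
    then show "orthogonal ?x y"
      using inner_basis_sum[of i "\<lambda>i. v \<bullet> e i"]
      by (simp only: orthogonal_def inner_diff_left diff_self)
  qed
  then have "?x = 0" by (simp only: orthogonal_self)
  then show ?thesis by (simp only: right_minus_eq)
qed

lemma linear_eq_on_basis:
  assumes "linear f" "linear g" "\<And>i. i \<in> I \<Longrightarrow> f (e i) = g (e i)"
  shows "f = g"
proof
  fix v
  show "f v = g v"
    by (rule linear_eq_on[OF assms(1,2), of v "e ` I"]) (use assms(3) span_basis in auto)
qed

lemma linear_perm_map: "linear (perm_map p)"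
  unfolding perm_map_def
  by (rule linearI)
    (simp_all only: inner_add_left scaleR_add_left sum.distrib scaleR_sum_right inner_scaleR_left scaleR_scaleR)

lemma perm_map_basis: "i \<in> I \<Longrightarrow> perm_map p (e i) = e (p i)"
proof -
  assume i: "i \<in> I"
  have "perm_map p (e i) = (\<Sum>j\<in>I. if j = i then e (p j) else 0)"
    unfolding perm_map_def by (rule sum.cong[OF refl]) (use i in \<open>auto simp: orthonormal\<close>)
  also have "\<dots> = e (p i)" using i by (simp only: sum.delta finite_atLeastAtMost if_True)
  finally show ?thesis .
qed

lemma perm_map_comp:
  assumes q: "q permutes I"
  shows "perm_map p \<circ> perm_map q = perm_map (p \<circ> q)"
proof (rule linear_eq_on_basis)
  show "linear (perm_map p \<circ> perm_map q)" by (intro linear_compose linear_perm_map)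
  fix i assume i: "i \<in> I"
  then have "q i \<in> I" using permutes_in_image[OF q] by blast
  then show "(perm_map p \<circ> perm_map q) (e i) = perm_map (p \<circ> q) (e i)"
    using i by (simp only: comp_apply perm_map_basis)
qed (rule linear_perm_map)

lemma perm_map_id: "perm_map id = id"
  by (rule linear_eq_on_basis) (simp_all only: linear_perm_map linear_id perm_map_basis id_apply)

lemma perm_map_inverse:
  assumes p: "p permutes I"
  shows "perm_map (inv_into UNIV p) (perm_map p v) = v" "perm_map p (perm_map (inv_into UNIV p) v) = v"
proof -
  show "perm_map (inv_into UNIV p) (perm_map p v) = v"
    using perm_map_comp[OF p, of "inv_into UNIV p"] permutes_inv_o(2)[OF p] perm_map_id
    by (metis comp_apply id_apply)
  show "perm_map p (perm_map (inv_into UNIV p) v) = v"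
    using perm_map_comp[OF permutes_inv[OF p], of p] permutes_inv_o(1)[OF p] perm_map_id
    by (metis comp_apply id_apply)
qed

lemma bij_perm_map: "p permutes I \<Longrightarrow> bij (perm_map p)"
  by (rule bijI') (metis perm_map_inverse)+

lemma inv_perm_map: "p permutes I \<Longrightarrow> inv_into UNIV (perm_map p) = perm_map (inv_into UNIV p)"
  by (rule inv_equality) (simp_all add: perm_map_inverse)

lemma basis_eq_iff: "i \<in> I \<Longrightarrow> j \<in> I \<Longrightarrow> e i = e j \<longleftrightarrow> i = j"
  by (metis orthonormal zero_neq_one)

lemma perm_map_inj: "inj_on perm_map {p. p permutes I}"
proof (rule inj_onI)
  fix p q assume "p \<in> {p. p permutes I}" "q \<in> {p. p permutes I}" and eq: "perm_map p = perm_map q"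
  then have p: "p permutes I" and q: "q permutes I" by auto
  show "p = q"
  proof
    fix i
    show "p i = q i"
    proof (cases "i \<in> I")
      case True
      then have "e (p i) = e (q i)" using eq perm_map_basis by metis
      moreover have "p i \<in> I" "q i \<in> I" using True permutes_in_image[OF p] permutes_in_image[OF q] by blast+
      ultimately show ?thesis using basis_eq_iff by blast
    next
      case False
      then show ?thesis using permutes_not_in[OF p] permutes_not_in[OF q] by metis
    qed
  qed
qed

lemma root_eq_iff:
  assumes "i \<in> I" "j \<in> I" "k \<in> I" "l \<in> I" "i \<noteq> j"
  shows "e i - e j = e k - e l \<longleftrightarrow> i = k \<and> j = l"
proof
  assume eq: "e i - e j = e k - e l"
  have "(e i - e j) \<bullet> e i = (e k - e l) \<bullet> e i" "(e i - e j) \<bullet> e j = (e k - e l) \<bullet> e j"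
    by (simp_all only: eq)
  then show "i = k \<and> j = l"
    using assms by (simp add: inner_diff_left orthonormal split: if_splits)
qed simp

lemma linear_reflection: "linear (reflection r)" for r :: 'a
  by (rule linearI)
    (simp_all add: reflection_def inner_add_left add_divide_distrib distrib_left scaleR_add_left
      scaleR_diff_right mult.left_commute)

lemma reflection_root:
  assumes i: "i \<in> I" and j: "j \<in> I" and ij: "i \<noteq> j"
  shows "reflection (e i - e j) = perm_map (Transposition.transpose i j)"
proof (rule linear_eq_on_basis)
  let ?r = "e i - e j"
  show "linear (reflection ?r)"
    by (rule linear_reflection)
  have rr: "?r \<bullet> ?r = 2"
    using assms by (simp add: inner_diff_left inner_diff_right orthonormal)
  fix k assume k: "k \<in> I"
  have "e k \<bullet> ?r = (if k = i then 1 else if k = j then -1 else 0)"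
    using assms k by (simp add: inner_diff_right orthonormal)
  then have "reflection ?r (e k) = e (Transposition.transpose i j k)"
    using ij by (simp add: reflection_def rr Transposition.transpose_def)
  then show "reflection ?r (e k) = perm_map (Transposition.transpose i j) (e k)"
    using perm_map_basis[OF k] by simp
qed (rule linear_perm_map)

text \<open>Reflections in roots are the transpositions of the basis vectors, and transpositions generate the symmetric group.\<close>

lemma weyl_group_eq: "weyl_group e n = perm_map ` {p. p permutes I}"
proof (intro subset_antisym subsetI)
  let ?G = "BijGroup (UNIV :: 'a set)"
  have memBij: "perm_map p \<in> Bij UNIV" if "p permutes I" for p
    using bij_perm_map[OF that] by (simp add: Bij_def)
  have mult: "perm_map p \<otimes>\<^bsub>?G\<^esub> perm_map q = perm_map (p \<circ> q)" if "p permutes I" "q permutes I" for p q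
    using memBij[OF that(1)] memBij[OF that(2)] perm_map_comp[OF that(2), of p]
    by (simp add: BijGroup_def compose_def fun_eq_iff)
  have one: "\<one>\<^bsub>?G\<^esub> = perm_map id"
    unfolding perm_map_id by (simp add: BijGroup_def fun_eq_iff)
  have refl_perm: "\<exists>i j. i \<in> I \<and> j \<in> I \<and> i \<noteq> j \<and> h = perm_map (Transposition.transpose i j)"
    if "h \<in> reflection ` roots e n" for h
    using that reflection_root unfolding roots_def by blast
  have trans_perm: "Transposition.transpose i j permutes I" if "i \<in> I" "j \<in> I" for i j
    using that by (rule permutes_swap_id)
  {
    fix f assume "f \<in> weyl_group e n"
    then have "f \<in> generate ?G (reflection ` roots e n)" by (simp add: weyl_group_def)
    then show "f \<in> perm_map ` {p. p permutes I}"
    proof (induction rule: generate.induct)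
      case one
      show ?case using \<open>\<one>\<^bsub>?G\<^esub> = perm_map id\<close> permutes_id by blast
    next
      case (incl h)
      then show ?case using refl_perm trans_perm by blast
    next
      case (inv h)
      then obtain i j where ij: "i \<in> I" "j \<in> I" and h: "h = perm_map (Transposition.transpose i j)"
        using refl_perm by blast
      have t: "Transposition.transpose i j permutes I" using trans_perm ij by blast
      have "h \<otimes>\<^bsub>?G\<^esub> h = \<one>\<^bsub>?G\<^esub>"
        unfolding h one mult[OF t t] by (simp only: transpose_comp_involutory)
      moreover have "h \<in> carrier ?G" using memBij[OF t] by (simp add: h BijGroup_def)
      ultimately have "inv\<^bsub>?G\<^esub> h = h"
        by (intro group.inv_equality[OF group_BijGroup])
      then show ?case using h t by auto
    next
      case (eng h1 h2)
      then obtain p q where pq: "p permutes I" "q permutes I" "h1 = perm_map p" "h2 = perm_map q"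
        by blast
      have "(p \<circ> q) permutes I" using permutes_compose[OF pq(2,1)] .
      then show ?case unfolding pq(3,4) mult[OF pq(1,2)] by blast
    qed
  }
  fix f assume "f \<in> perm_map ` {p. p permutes I}"
  then obtain p where p: "p permutes I" and f: "f = perm_map p" by blast
  have "perm_map p \<in> generate ?G (reflection ` roots e n)"
    using p finite_atLeastAtMost
  proof (induction rule: permutes_induct)
    case id
    show ?case unfolding one[symmetric] by (rule generate.one)
  next
    case (swap a b p)
    have "e a - e b \<in> roots e n" using swap unfolding roots_def by blast
    then have "perm_map (Transposition.transpose a b) \<in> reflection ` roots e n"
      using reflection_root[OF swap(1-3)] by (metis imageI)
    then have "perm_map (Transposition.transpose a b) \<otimes>\<^bsub>?G\<^esub> perm_map p
        \<in> generate ?G (reflection ` roots e n)"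
      by (intro generate.eng[OF generate.incl swap(5)])
    then show ?case by (simp only: mult[OF trans_perm[OF swap(1,2)] swap(4)])
  qed
  then show "f \<in> weyl_group e n" by (simp add: weyl_group_def f)
qed

section \<open>Roots, distinguished representatives and structure constants\<close>

lemma simple_roots_eq: "simple_roots e n = simple ` {1..<n+1}"
  unfolding simple_roots_def simple_def by (auto simp: less_Suc_eq_le)

lemma simple_in_index: "i \<in> {1..<n+1} \<Longrightarrow> i \<in> I \<and> Suc i \<in> I"
  by auto

lemma inj_simple: "inj_on simple {1..<n+1}"
proof (rule inj_onI)
  fix i j assume "i \<in> {1..<n+1}" "j \<in> {1..<n+1}" "simple i = simple j"
  then show "i = j"
    using root_eq_iff[of i "Suc i" j "Suc j"] simple_in_index n_not_Suc_n
    unfolding simple_def by metis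
qed

text \<open>For \<open>i < j\<close> the root is a telescoping sum of simple roots. Conversely, the vector \<open>h\<close> with coordinates
  \<open>-1, -2, \<dots>\<close> has inner product \<open>1\<close> with every simple root, hence a nonnegative one with every positive root.\<close>

lemma pos_root_iff:
  assumes i: "i \<in> I" and j: "j \<in> I" and ij: "i \<noteq> j"
  shows "e i - e j \<in> pos_roots e n \<longleftrightarrow> i < j"
proof
  assume "i < j"
  define c where "c s = (if s \<in> simple ` {i..<j} then 1 else 0 :: real)" for s
  have sub: "{i..<j} \<subseteq> {1..<n+1}" using i j by auto
  have "(\<Sum>k\<in>{i..<j}. e k - e (Suc k)) = e i - e j"
    using sum_Suc_diff'[of i j "\<lambda>k. - e k"] \<open>i < j\<close> by simp
  then have "e i - e j = (\<Sum>k\<in>{i..<j}. simple k)" by (simp add: simple_def)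
  also have "\<dots> = (\<Sum>s\<in>simple ` {i..<j}. s)"
    using sum.reindex[OF inj_on_subset[OF inj_simple sub], of "\<lambda>s. s"] by simp
  also have "\<dots> = (\<Sum>s\<in>simple ` {i..<j}. c s *\<^sub>R s)"
    by (rule sum.cong) (simp_all add: c_def)
  also have "\<dots> = (\<Sum>s\<in>simple ` {1..<n+1}. c s *\<^sub>R s)"
    by (rule sum.mono_neutral_left) (use sub in \<open>auto simp: c_def\<close>)
  finally have "e i - e j = (\<Sum>s\<in>simple_roots e n. c s *\<^sub>R s)" by (simp only: simple_roots_eq)
  moreover have "\<forall>s\<in>simple_roots e n. c s \<ge> 0" by (simp add: c_def)
  moreover have "e i - e j \<in> roots e n" using assms unfolding roots_def by blast
  ultimately show "e i - e j \<in> pos_roots e n" unfolding pos_roots_def by blast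
next
  assume "e i - e j \<in> pos_roots e n"
  then obtain c where c: "\<And>s. s \<in> simple_roots e n \<Longrightarrow> c s \<ge> 0"
    and eq: "e i - e j = (\<Sum>s\<in>simple_roots e n. c s *\<^sub>R s)"
    unfolding pos_roots_def by blast
  define h where "h = (\<Sum>k\<in>I. (- real k) *\<^sub>R e k)"
  have h: "h \<bullet> (e k - e l) = real l - real k" if "k \<in> I" "l \<in> I" for k l
    unfolding h_def inner_diff_right inner_basis_sum[OF that(1)] inner_basis_sum[OF that(2)] by simp
  have "h \<bullet> s \<ge> 0" if s: "s \<in> simple_roots e n" for s
  proof -
    obtain k where "k \<in> {1..<n+1}" "s = e k - e (Suc k)"
      using s unfolding simple_roots_eq simple_def by blast
    then show ?thesis using h simple_in_index by simp
  qed
  then have "h \<bullet> (\<Sum>s\<in>simple_roots e n. c s *\<^sub>R s) \<ge> 0"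
    unfolding inner_sum_right using c by (intro sum_nonneg) simp
  then have "real j - real i \<ge> 0" using h[OF i j] eq by simp
  then show "i < j" using ij by simp
qed

lemma perm_map_simple:
  "a \<in> {1..<n+1} \<Longrightarrow> perm_map w (simple a) = e (w a) - e (w (Suc a))"
  unfolding simple_def linear_diff[OF linear_perm_map]
  using simple_in_index perm_map_basis by metis

lemma perm_map_simple_pos_iff:
  assumes w: "w permutes I" and a: "a \<in> {1..<n+1}"
  shows "perm_map w (simple a) \<in> pos_roots e n \<longleftrightarrow> w a < w (Suc a)"
proof -
  have "w a \<in> I" "w (Suc a) \<in> I" using simple_in_index[OF a] permutes_in_image[OF w] by blast+
  moreover have "w a \<noteq> w (Suc a)" using permutes_inj[OF w] by (metis injD n_not_Suc_n)
  ultimately show ?thesis unfolding perm_map_simple[OF a] by (rule pos_root_iff)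
qed

lemma perm_map_simple_eq_iff:
  assumes w: "w permutes I" and a: "a \<in> {1..<n+1}" and b: "b \<in> {1..<n+1}"
  shows "perm_map w (simple b) = simple a \<longleftrightarrow> w b = a \<and> w (Suc b) = Suc a"
proof -
  have "w b \<in> I" "w (Suc b) \<in> I" using simple_in_index[OF b] permutes_in_image[OF w] by blast+
  moreover have "w b \<noteq> w (Suc b)" using permutes_inj[OF w] by (metis injD n_not_Suc_n)
  moreover have "a \<in> I" "Suc a \<in> I" using simple_in_index[OF a] by blast+
  ultimately show ?thesis
    unfolding perm_map_simple[OF b] unfolding simple_def by (intro root_eq_iff)
qed

lemma dist_reps_eq:
  assumes "A \<subseteq> {1..<n+1}"
  shows "dist_reps e n (simple ` A) = perm_map ` {w. w permutes I \<and> (\<forall>a\<in>A. w a < w (Suc a))}"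
proof -
  have "perm_map w ` simple ` A \<subseteq> pos_roots e n \<longleftrightarrow> (\<forall>a\<in>A. w a < w (Suc a))"
    if "w permutes I" for w
    using perm_map_simple_pos_iff[OF that] assms by blast
  then show ?thesis unfolding dist_reps_def weyl_group_eq by blast
qed

lemma dist_double_reps_eq:
  assumes A: "A \<subseteq> {1..<n+1}" and B: "B \<subseteq> {1..<n+1}"
  shows "dist_double_reps e n (simple ` A) (simple ` B) = perm_map ` double_perms (n+1) A B"
proof (intro subset_antisym subsetI)
  fix f assume "f \<in> dist_double_reps e n (simple ` A) (simple ` B)"
  then have f: "f \<in> inv_into UNIV ` dist_reps e n (simple ` A)" "f \<in> dist_reps e n (simple ` B)"
    by (auto simp: dist_double_reps_def)
  obtain v where v: "v permutes I" "\<forall>a\<in>A. v a < v (Suc a)" "f = inv_into UNIV (perm_map v)"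
    using f(1) unfolding dist_reps_eq[OF A] by blast
  obtain w where w: "w permutes I" "\<forall>b\<in>B. w b < w (Suc b)" "f = perm_map w"
    using f(2) unfolding dist_reps_eq[OF B] by blast
  have "w = inv_into UNIV v"
    using inj_onD[OF perm_map_inj, of w "inv_into UNIV v"] v w permutes_inv[OF v(1)] inv_perm_map[OF v(1)]
    by simp
  then have "inv_into UNIV w = v" using permutes_inv_inv[OF v(1)] by simp
  then have "w \<in> double_perms (n+1) A B" using v w by (simp add: double_perms_def)
  then show "f \<in> perm_map ` double_perms (n+1) A B" using w(3) by blast
next
  fix f assume "f \<in> perm_map ` double_perms (n+1) A B"
  then obtain w where w: "w permutes I" "\<forall>b\<in>B. w b < w (Suc b)"
      "\<forall>a\<in>A. inv_into UNIV w a < inv_into UNIV w (Suc a)" "f = perm_map w"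
    unfolding double_perms_def by blast
  have w': "inv_into UNIV w permutes I" by (rule permutes_inv[OF w(1)])
  have "f = inv_into UNIV (perm_map (inv_into UNIV w))"
    using inv_perm_map[OF w'] permutes_inv_inv[OF w(1)] w(4) by simp
  moreover have "perm_map (inv_into UNIV w) \<in> dist_reps e n (simple ` A)"
    unfolding dist_reps_eq[OF A] using w' w(3) by blast
  moreover have "f \<in> dist_reps e n (simple ` B)"
    unfolding dist_reps_eq[OF B] using w by blast
  ultimately show "f \<in> dist_double_reps e n (simple ` A) (simple ` B)"
    unfolding dist_double_reps_def by blast
qed

lemma inverse_image_Int_simple:
  assumes A: "A \<subseteq> {1..<n+1}" and B: "B \<subseteq> {1..<n+1}" and w: "w permutes I"
  shows "inv_into UNIV (perm_map w) ` simple ` A \<inter> simple ` B = simple ` stab_meet A B w"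
proof -
  have iff: "simple b \<in> inv_into UNIV (perm_map w) ` simple ` A \<longleftrightarrow> b \<in> stab_meet A B w" if b: "b \<in> B" for b
  proof -
    have "simple b = inv_into UNIV (perm_map w) x \<longleftrightarrow> perm_map w (simple b) = x" for x
      unfolding inv_perm_map[OF w] using perm_map_inverse[OF w] by metis
    then have "simple b \<in> inv_into UNIV (perm_map w) ` simple ` A \<longleftrightarrow>
        (\<exists>a\<in>A. perm_map w (simple b) = simple a)" by blast
    also have "\<dots> \<longleftrightarrow> (\<exists>a\<in>A. w b = a \<and> w (Suc b) = Suc a)"
      using perm_map_simple_eq_iff[OF w] A B b by (metis subsetD)
    also have "\<dots> \<longleftrightarrow> b \<in> stab_meet A B w" using b by (auto simp: stab_meet_def)
    finally show ?thesis .
  qed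
  have sub: "stab_meet A B w \<subseteq> B" by (auto simp: stab_meet_def)
  show ?thesis
  proof (intro subset_antisym subsetI)
    fix x assume x: "x \<in> inv_into UNIV (perm_map w) ` simple ` A \<inter> simple ` B"
    then obtain b where "b \<in> B" "x = simple b" by blast
    then show "x \<in> simple ` stab_meet A B w" using iff x by blast
  next
    fix x assume "x \<in> simple ` stab_meet A B w"
    then obtain b where b: "b \<in> stab_meet A B w" "x = simple b" by blast
    then have "b \<in> B" using sub by blast
    then show "x \<in> inv_into UNIV (perm_map w) ` simple ` A \<inter> simple ` B" using iff b by blast
  qed
qed

lemma struct_const_eq:
  assumes A: "A \<subseteq> {1..<n+1}" and B: "B \<subseteq> {1..<n+1}" and C: "C \<subseteq> {1..<n+1}"
  shows "struct_const e n (simple ` A) (simple ` B) (simple ` C) =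
    card {w \<in> double_perms (n+1) A B. stab_meet A B w = C}"
proof -
  have perm: "w permutes I" if "w \<in> double_perms (n+1) A B" for w
    using that by (simp add: double_perms_def)
  have "stab_meet A B w \<subseteq> {1..<n+1}" for w
    using B unfolding stab_meet_def by blast
  then have "simple ` stab_meet A B w = simple ` C \<longleftrightarrow> stab_meet A B w = C" for w
    by (rule inj_on_image_eq_iff[OF inj_simple _ C])
  then have "inv_into UNIV (perm_map w) ` simple ` A \<inter> simple ` B = simple ` C \<longleftrightarrow>
      stab_meet A B w = C" if "w \<in> double_perms (n+1) A B" for w
    using inverse_image_Int_simple[OF A B perm[OF that]] by simp
  then have "{f \<in> dist_double_reps e n (simple ` A) (simple ` B).
      inv_into UNIV f ` simple ` A \<inter> simple ` B = simple ` C} =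
    perm_map ` {w \<in> double_perms (n+1) A B. stab_meet A B w = C}"
    unfolding dist_double_reps_eq[OF A B] by blast
  moreover have "inj_on perm_map {w \<in> double_perms (n+1) A B. stab_meet A B w = C}"
    by (rule inj_on_subset[OF perm_map_inj]) (use perm in auto)
  ultimately show ?thesis by (simp add: struct_const_def card_image)
qed

lemma root_equiv_iff:
  assumes A: "A \<subseteq> {1..<n+1}" and B: "B \<subseteq> {1..<n+1}"
  shows "root_equiv e n (simple ` A) (simple ` B) \<longleftrightarrow>
    (\<exists>w. w permutes I \<and> (\<forall>a\<in>A. w a \<in> B \<and> w (Suc a) = Suc (w a)) \<and> B \<subseteq> w ` A)"
proof -
  have "perm_map w ` simple ` A = simple ` B \<longleftrightarrow>
    (\<forall>a\<in>A. w a \<in> B \<and> w (Suc a) = Suc (w a)) \<and> B \<subseteq> w ` A" if w: "w permutes I" for w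
  proof -
    have iff: "perm_map w (simple a) = simple b \<longleftrightarrow> w a = b \<and> w (Suc a) = Suc b"
      if "a \<in> A" "b \<in> B" for a b
      using perm_map_simple_eq_iff[OF w, of b a] that A B by blast
    have "perm_map w ` simple ` A \<subseteq> simple ` B \<longleftrightarrow> (\<forall>a\<in>A. \<exists>b\<in>B. perm_map w (simple a) = simple b)"
      by blast
    also have "\<dots> \<longleftrightarrow> (\<forall>a\<in>A. w a \<in> B \<and> w (Suc a) = Suc (w a))"
      using iff by metis
    finally have 1: "perm_map w ` simple ` A \<subseteq> simple ` B \<longleftrightarrow> (\<forall>a\<in>A. w a \<in> B \<and> w (Suc a) = Suc (w a))" .
    have "simple ` B \<subseteq> perm_map w ` simple ` A \<longleftrightarrow> (\<forall>b\<in>B. \<exists>a\<in>A. perm_map w (simple a) = simple b)"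
      unfolding image_subset_iff by (simp only: image_iff bex_simps) (simp only: eq_commute)
    also have "\<dots> \<longleftrightarrow> (\<forall>b\<in>B. \<exists>a\<in>A. w a = b \<and> w (Suc a) = Suc b)"
      by (intro ball_cong bex_cong refl iff)
    finally have 2: "simple ` B \<subseteq> perm_map w ` simple ` A \<longleftrightarrow>
      (\<forall>b\<in>B. \<exists>a\<in>A. w a = b \<and> w (Suc a) = Suc b)" .
    show ?thesis unfolding set_eq_subset 1 2
    proof (intro conj_cong refl)
      assume "\<forall>a\<in>A. w a \<in> B \<and> w (Suc a) = Suc (w a)"
      then show "(\<forall>b\<in>B. \<exists>a\<in>A. w a = b \<and> w (Suc a) = Suc b) \<longleftrightarrow> B \<subseteq> w ` A"
        unfolding subset_iff image_iff by metis
    qed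
  qed
  then show ?thesis unfolding root_equiv_def weyl_group_eq by blast
qed

lemma finite_dist_reps:
  assumes "A \<subseteq> {1..<n+1}"
  shows "finite (dist_reps e n (simple ` A))"
  unfolding dist_reps_eq[OF assms]
  by (rule finite_imageI, rule finite_subset[OF _ finite_permutations[of I]]) auto

text \<open>The transposition \<open>(a, a + 1)\<close> makes only the simple root numbered \<open>a\<close> negative, so it lies in \<open>X\<^sub>C\<close> exactly
  when \<open>a \<notin> C\<close>. Thus \<open>X\<^sub>C\<close> determines \<open>C\<close>.\<close>

lemma x_elt_inj:
  assumes A: "A \<subseteq> {1..<n+1}" and B: "B \<subseteq> {1..<n+1}"
    and eq: "x_elt e n (simple ` A) = x_elt e n (simple ` B)"
  shows "A = B"
proof -
  have lookup: "Poly_Mapping.lookup (x_elt e n (simple ` C)) f = (if f \<in> dist_reps e n (simple ` C) then 1 else 0)"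
    if "C \<subseteq> {1..<n+1}" for C f
    unfolding x_elt_def lookup_sum using finite_dist_reps[OF that]
    by (simp add: lookup_single when_def)
  have "dist_reps e n (simple ` A) = dist_reps e n (simple ` B)"
  proof (rule Set.set_eqI)
    fix f
    show "f \<in> dist_reps e n (simple ` A) \<longleftrightarrow> f \<in> dist_reps e n (simple ` B)"
      using lookup[OF A, of f] lookup[OF B, of f] eq by (simp split: if_splits)
  qed
  moreover have "a \<in> C \<longleftrightarrow> perm_map (Transposition.transpose a (Suc a)) \<notin> dist_reps e n (simple ` C)"
    if a: "a \<in> {1..<n+1}" and C: "C \<subseteq> {1..<n+1}" for a C
  proof -
    let ?t = "Transposition.transpose a (Suc a)"
    have t: "?t permutes I" using simple_in_index[OF a] by (intro permutes_swap_id) auto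
    have "perm_map ?t \<in> dist_reps e n (simple ` C) \<longleftrightarrow> (\<forall>c\<in>C. ?t c < ?t (Suc c))"
      unfolding dist_reps_eq[OF C] using t perm_map_inj by (auto dest: inj_onD)
    also have "\<dots> \<longleftrightarrow> a \<notin> C"
      by (auto simp: Transposition.transpose_def)
    finally show ?thesis by blast
  qed
  ultimately show ?thesis using A B by blast
qed

section \<open>Conjugacy of sets of simple roots\<close>

definition root_class :: "nat set \<Rightarrow> (('a \<Rightarrow> 'a) \<Rightarrow>\<^sub>0 rat) set" where
  "root_class A = x_class e n (simple ` A)"

lemma root_equiv_refl: "root_equiv e n J J"
  unfolding root_equiv_def weyl_group_eq
proof (rule bexI)
  show "perm_map id ` J = J" by (simp add: perm_map_id)
  show "perm_map id \<in> perm_map ` {p. p permutes I}" using permutes_id by blast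
qed

lemma root_equiv_sym: "root_equiv e n J K \<Longrightarrow> root_equiv e n K J"
proof -
  assume "root_equiv e n J K"
  then obtain w where w: "w permutes I" "perm_map w ` J = K"
    unfolding root_equiv_def weyl_group_eq by blast
  then have "perm_map (inv_into UNIV w) ` K = J"
    using perm_map_inverse(1)[OF w(1)] by (force simp: image_image)
  then show ?thesis
    unfolding root_equiv_def weyl_group_eq using permutes_inv[OF w(1)] by blast
qed

lemma root_equiv_trans: "root_equiv e n J K \<Longrightarrow> root_equiv e n K L \<Longrightarrow> root_equiv e n J L"
proof -
  assume "root_equiv e n J K" "root_equiv e n K L"
  then obtain v w where vw: "v permutes I" "perm_map v ` J = K" "w permutes I" "perm_map w ` K = L"
    unfolding root_equiv_def weyl_group_eq by blast
  then have "perm_map (w \<circ> v) ` J = L"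
    using perm_map_comp[OF vw(1), of w] by (metis image_comp)
  then show ?thesis
    unfolding root_equiv_def weyl_group_eq using permutes_compose[OF vw(1,3)] by blast
qed

text \<open>A class is a set of elements \<open>x\<^sub>K\<close>; that it remembers the sets \<open>K\<close> themselves, and hence the conjugacy
  relation, uses the injectivity of \<open>K \<mapsto> x\<^sub>K\<close>.\<close>

lemma root_class_eq_iff:
  assumes A: "A \<subseteq> {1..<n+1}" and B: "B \<subseteq> {1..<n+1}"
  shows "root_class A = root_class B \<longleftrightarrow> root_equiv e n (simple ` A) (simple ` B)"
proof
  assume "root_equiv e n (simple ` A) (simple ` B)"
  then show "root_class A = root_class B"
    unfolding root_class_def x_class_def using root_equiv_sym root_equiv_trans by blast
next
  assume "root_class A = root_class B"
  moreover have "simple ` A \<subseteq> simple_roots e n" using A simple_roots_eq by blast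
  then have "x_elt e n (simple ` A) \<in> root_class A"
    unfolding root_class_def x_class_def using root_equiv_refl by blast
  ultimately have "x_elt e n (simple ` A) \<in> x_class e n (simple ` B)"
    by (simp only: root_class_def)
  then obtain K where K: "K \<subseteq> simple_roots e n" "root_equiv e n K (simple ` B)"
      "x_elt e n (simple ` A) = x_elt e n K"
    unfolding x_class_def by blast
  obtain C where C: "C \<subseteq> {1..<n+1}" "K = simple ` C"
    using K(1) unfolding simple_roots_eq by (meson subset_imageE)
  then have "A = C" using x_elt_inj[OF A C(1)] K(3) by simp
  then show "root_equiv e n (simple ` A) (simple ` B)" using K C by simp
qed

lemma marks_class_cong:
  assumes A: "A \<subseteq> {1..<n+1}" and B: "B \<subseteq> {1..<n+1}" and M: "M \<subseteq> {1..<n+1}"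
    and "root_class A = root_class B"
  shows "marks (n+1) A M = marks (n+1) B M"
  using marks_conj[OF A B M] assms(4) unfolding root_class_eq_iff[OF A B] root_equiv_iff[OF A B] by blast

text \<open>An embedding of \<open>B\<close> into \<open>A\<close> by an element of \<open>W\<close> is onto, which is conjugacy, or shows that \<open>B\<close> has fewer elements.\<close>

lemma marks_nonzero_cases:
  assumes A: "A \<subseteq> {1..<n+1}" and B: "B \<subseteq> {1..<n+1}" and nz: "marks (n+1) A B \<noteq> 0"
  shows "card B < card A \<or> root_class A = root_class B"
proof -
  obtain w where w: "w permutes I" "\<forall>b\<in>B. w b \<in> A \<and> w (Suc b) = Suc (w b)"
    using marks_nonzero_embedding[OF A B nz] by blast
  have fin: "finite A" using A by (rule finite_subset) simp
  have sub: "w ` B \<subseteq> A" using w by blast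
  have card: "card (w ` B) = card B" by (rule card_image[OF permutes_inj_on[OF w(1)]])
  show ?thesis
  proof (cases "w ` B = A")
    case True
    then have "root_equiv e n (simple ` B) (simple ` A)"
      unfolding root_equiv_iff[OF B A] using w by blast
    then show ?thesis using root_class_eq_iff[OF B A] by simp
  next
    case False
    then show ?thesis using psubset_card_mono[OF fin, of "w ` B"] sub card by auto
  qed
qed

end

section \<open>Algebras embedded into functions\<close>

lemma lookup_scale [simp]: "Poly_Mapping.lookup (scale q f) k = q * Poly_Mapping.lookup f k"
  by (simp add: scale_def Poly_Mapping.map.rep_eq when_def)

lemma scale_0: "scale 0 f = 0"
  by (rule poly_mapping_eqI) simp

definition spanned :: "'c set \<Rightarrow> ('c \<Rightarrow>\<^sub>0 rat) set" where
  "spanned S = {f. Poly_Mapping.keys f \<subseteq> S}"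

lemma spanned_iff: "f \<in> spanned S \<longleftrightarrow> (\<forall>k. k \<notin> S \<longrightarrow> Poly_Mapping.lookup f k = 0)"
  by (auto simp: spanned_def in_keys_iff)

lemma spanned_zero: "0 \<in> spanned S"
  and spanned_add: "f \<in> spanned S \<Longrightarrow> g \<in> spanned S \<Longrightarrow> f + g \<in> spanned S"
  and spanned_uminus: "f \<in> spanned S \<Longrightarrow> - f \<in> spanned S"
  and spanned_scale: "f \<in> spanned S \<Longrightarrow> scale q f \<in> spanned S"
  and spanned_single: "k \<in> S \<Longrightarrow> Poly_Mapping.single k q \<in> spanned S"
  by (auto simp: spanned_iff lookup_add lookup_single when_def)

lemma spanned_sum: "(\<And>i. i \<in> F \<Longrightarrow> b i \<in> spanned S) \<Longrightarrow> sum b F \<in> spanned S"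
  by (induction F rule: infinite_finite_induct) (auto intro: spanned_zero spanned_add)

lemma spanned_expand:
  assumes "finite S" "f \<in> spanned S"
  shows "f = (\<Sum>k\<in>S. scale (Poly_Mapping.lookup f k) (Poly_Mapping.single k 1))"
proof (rule poly_mapping_eqI)
  fix l
  have "Poly_Mapping.lookup (\<Sum>k\<in>S. scale (Poly_Mapping.lookup f k) (Poly_Mapping.single k 1)) l
      = (\<Sum>k\<in>S. if k = l then Poly_Mapping.lookup f k else 0)"
    unfolding lookup_sum by (rule sum.cong) (auto simp: lookup_single)
  also have "\<dots> = Poly_Mapping.lookup f l"
    using assms by (simp add: spanned_iff)
  finally show "Poly_Mapping.lookup f l = Poly_Mapping.lookup
    (\<Sum>k\<in>S. scale (Poly_Mapping.lookup f k) (Poly_Mapping.single k 1)) l" ..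
qed

lemma linear_on_spanned_sum:
  fixes T :: "('c \<Rightarrow>\<^sub>0 rat) \<Rightarrow> ('d \<Rightarrow>\<^sub>0 rat)"
  assumes add: "\<And>f g. f \<in> spanned S \<Longrightarrow> g \<in> spanned S \<Longrightarrow> T (f + g) = T f + T g"
    and scl: "\<And>q f. f \<in> spanned S \<Longrightarrow> T (scale q f) = scale q (T f)"
    and b: "\<And>i. i \<in> F \<Longrightarrow> b i \<in> spanned S" and fin: "finite F"
  shows "T (\<Sum>i\<in>F. scale (a i) (b i)) = (\<Sum>i\<in>F. scale (a i) (T (b i)))"
  using fin b
proof (induction F rule: finite_induct)
  case empty
  show ?case using scl[OF spanned_zero, of 0] by (simp add: scale_0)
next
  case (insert i F)
  have "scale (a i) (b i) \<in> spanned S" "(\<Sum>i\<in>F. scale (a i) (b i)) \<in> spanned S"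
    using insert.prems by (auto intro: spanned_scale spanned_sum)
  then show ?case using insert add scl by simp
qed

text \<open>Expanding both arguments in the basis expresses a bilinear product through its values on basis vectors.\<close>

lemma bilinear_on_unique:
  assumes fin: "finite S" and m: "bilinear_on (spanned S) m" and m': "bilinear_on (spanned S) m'"
    and eq: "\<And>c d. c \<in> S \<Longrightarrow> d \<in> S \<Longrightarrow>
      m' (Poly_Mapping.single c 1) (Poly_Mapping.single d 1) =
      m (Poly_Mapping.single c 1) (Poly_Mapping.single d 1)"
    and f: "f \<in> spanned S" and g: "g \<in> spanned S"
  shows "m' f g = m f g"
proof -
  let ?s = "\<lambda>k. Poly_Mapping.single k (1 :: rat)"
  let ?l = Poly_Mapping.lookup
  have expand: "p f g = (\<Sum>c\<in>S. scale (?l f c) (\<Sum>d\<in>S. scale (?l g d) (p (?s c) (?s d))))"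
    if p: "bilinear_on (spanned S) p" for p
  proof -
    have "p f g = p (\<Sum>c\<in>S. scale (?l f c) (?s c)) g"
      using spanned_expand[OF fin f] by simp
    also have "\<dots> = (\<Sum>c\<in>S. scale (?l f c) (p (?s c) g))"
      using p g by (intro linear_on_spanned_sum[where S = S] fin spanned_single)
        (auto simp: bilinear_on_def)
    also have "\<dots> = (\<Sum>c\<in>S. scale (?l f c) (\<Sum>d\<in>S. scale (?l g d) (p (?s c) (?s d))))"
    proof (rule sum.cong[OF refl], rule arg_cong[where f = "scale _"])
      fix c assume c: "c \<in> S"
      have "p (?s c) g = p (?s c) (\<Sum>d\<in>S. scale (?l g d) (?s d))"
        using spanned_expand[OF fin g] by simp
      also have "\<dots> = (\<Sum>d\<in>S. scale (?l g d) (p (?s c) (?s d)))"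
        using p spanned_single[OF c] by (intro linear_on_spanned_sum[where S = S] fin spanned_single)
          (auto simp: bilinear_on_def)
      finally show "p (?s c) g = (\<Sum>d\<in>S. scale (?l g d) (p (?s c) (?s d)))" .
    qed
    finally show ?thesis .
  qed
  show ?thesis unfolding expand[OF m] expand[OF m'] by (intro sum.cong refl arg_cong[where f = "scale _"]) (simp add: eq)
qed

text \<open>A finite basis \<open>S\<close> whose elements are represented by linearly independent functions \<open>\<chi> k\<close> on \<open>T\<close>, so that the
  space spanned by \<open>S\<close> embeds into the functions on \<open>T\<close>.\<close>

locale separated_basis =
  fixes S :: "'c set" and T :: "'m set" and \<chi> :: "'c \<Rightarrow> 'm \<Rightarrow> rat"
  assumes finite_basis: "finite S"
    and independent: "\<And>f. f \<in> spanned S \<Longrightarrow>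
      (\<And>x. x \<in> T \<Longrightarrow> (\<Sum>k\<in>S. Poly_Mapping.lookup f k * \<chi> k x) = 0) \<Longrightarrow> f = 0"
begin

definition eval_at :: "('c \<Rightarrow>\<^sub>0 rat) \<Rightarrow> 'm \<Rightarrow> rat" where
  "eval_at f x = (\<Sum>k\<in>S. Poly_Mapping.lookup f k * \<chi> k x)"

lemma eval_at_add: "eval_at (f + g) x = eval_at f x + eval_at g x"
  by (simp add: eval_at_def lookup_add distrib_right sum.distrib)

lemma eval_at_scale: "eval_at (scale q f) x = q * eval_at f x"
  by (simp add: eval_at_def sum_distrib_left mult.assoc)

lemma eval_at_sum: "eval_at (\<Sum>i\<in>F. b i) x = (\<Sum>i\<in>F. eval_at (b i) x)"
  by (induction F rule: infinite_finite_induct) (simp_all add: eval_at_add, simp_all add: eval_at_def)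

lemma eval_at_single: "k \<in> S \<Longrightarrow> eval_at (Poly_Mapping.single k 1) x = \<chi> k x"
proof -
  assume k: "k \<in> S"
  have "eval_at (Poly_Mapping.single k 1) x = (\<Sum>l\<in>S. if l = k then \<chi> l x else 0)"
    unfolding eval_at_def by (rule sum.cong) (auto simp: lookup_single)
  then show ?thesis using k finite_basis by simp
qed

lemma eval_at_inj:
  assumes f: "f \<in> spanned S" and g: "g \<in> spanned S" and eq: "\<And>x. x \<in> T \<Longrightarrow> eval_at f x = eval_at g x"
  shows "f = g"
proof -
  have "f + scale (-1) g = 0"
  proof (rule independent)
    show "f + scale (-1) g \<in> spanned S" using f g by (intro spanned_add spanned_scale)
    fix x assume "x \<in> T"
    then have "eval_at (f + scale (-1) g) x = 0" using eq by (simp add: eval_at_add eval_at_scale)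
    then show "(\<Sum>k\<in>S. Poly_Mapping.lookup (f + scale (-1) g) k * \<chi> k x) = 0"
      by (simp only: eval_at_def)
  qed
  then have "Poly_Mapping.lookup (f + scale (-1) g) k = 0" for k by simp
  then show ?thesis by (intro poly_mapping_eqI) (simp add: lookup_add)
qed

end

text \<open>In addition, pointwise products of the functions \<open>\<chi> c\<close> stay in their span, with coordinates given by \<open>\<mu>\<close>. Every
  identity between products in the space then follows from the same identity between rational numbers, by the
  injectivity of evaluation.\<close>

locale multiplicative_basis = separated_basis S T \<chi>
  for S :: "'c set" and T :: "'m set" and \<chi> +
  fixes \<mu> :: "'c \<Rightarrow> 'c \<Rightarrow> ('c \<Rightarrow>\<^sub>0 rat)" and u :: 'c
  assumes prod_closed: "\<And>c d. c \<in> S \<Longrightarrow> d \<in> S \<Longrightarrow> \<mu> c d \<in> spanned S"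
    and eval_at_prod: "\<And>c d x. c \<in> S \<Longrightarrow> d \<in> S \<Longrightarrow> x \<in> T \<Longrightarrow> eval_at (\<mu> c d) x = \<chi> c x * \<chi> d x"
    and unit_in: "u \<in> S" and unit_eval: "\<And>x. x \<in> T \<Longrightarrow> \<chi> u x = 1"
begin

definition product :: "('c \<Rightarrow>\<^sub>0 rat) \<Rightarrow> ('c \<Rightarrow>\<^sub>0 rat) \<Rightarrow> ('c \<Rightarrow>\<^sub>0 rat)" where
  "product f g = (\<Sum>c\<in>S. \<Sum>d\<in>S. scale (Poly_Mapping.lookup f c * Poly_Mapping.lookup g d) (\<mu> c d))"

lemma product_in: "product f g \<in> spanned S"
  unfolding product_def by (intro spanned_sum spanned_scale prod_closed)

lemma eval_at_mult: "x \<in> T \<Longrightarrow> eval_at (product f g) x = eval_at f x * eval_at g x"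
proof -
  assume x: "x \<in> T"
  have "eval_at (product f g) x = (\<Sum>c\<in>S. \<Sum>d\<in>S.
      (Poly_Mapping.lookup f c * \<chi> c x) * (Poly_Mapping.lookup g d * \<chi> d x))"
    unfolding product_def eval_at_sum eval_at_scale
    by (intro sum.cong refl) (simp add: eval_at_prod x)
  then show ?thesis by (simp only: eval_at_def sum_product)
qed

lemmas eval_simps = eval_at_mult eval_at_add eval_at_scale eval_at_single

lemma product_basis: "c \<in> S \<Longrightarrow> d \<in> S \<Longrightarrow> product (Poly_Mapping.single c 1) (Poly_Mapping.single d 1) = \<mu> c d"
  by (rule eval_at_inj) (simp_all add: product_in prod_closed eval_simps eval_at_prod)

lemma bilinear_product: "bilinear_on (spanned S) product"
  unfolding bilinear_on_def
proof (intro conjI ballI allI)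
  fix f g h q assume f: "f \<in> spanned S" and g: "g \<in> spanned S" and h: "h \<in> spanned S"
  show "product (f + g) h = product f h + product g h" "product h (f + g) = product h f + product h g"
    by (rule eval_at_inj; simp add: product_in spanned_add eval_simps algebra_simps)+
next
  fix f g q assume f: "f \<in> spanned S" and g: "g \<in> spanned S"
  show "product (scale q f) g = scale q (product f g)" "product f (scale q g) = scale q (product f g)"
    by (rule eval_at_inj; simp add: product_in spanned_scale eval_simps algebra_simps)+
qed (rule product_in)

lemma assoc_algebra_product:
  "assoc_algebra (ring_of_type_algebra :: rat ring)
     \<lparr>carrier = spanned S, monoid.mult = product, one = Poly_Mapping.single u 1,
      ring.zero = 0, add = (+), module.smult = scale\<rparr>"
    (is "assoc_algebra ?R ?M")
proof -
  have R: "cring ?R" by (rule cring_from_type_algebra)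
  have M: "abelian_group ?M"
  proof (rule abelian_groupI)
    fix f assume "f \<in> carrier ?M"
    then show "\<exists>g\<in>carrier ?M. g \<oplus>\<^bsub>?M\<^esub> f = \<zero>\<^bsub>?M\<^esub>"
      by (intro bexI[where x = "- f"]) (simp_all add: spanned_uminus)
  qed (simp_all add: spanned_add spanned_zero add_ac)
  have mon: "Group.monoid ?M"
  proof (rule monoidI)
    show "f \<otimes>\<^bsub>?M\<^esub> g \<otimes>\<^bsub>?M\<^esub> h = f \<otimes>\<^bsub>?M\<^esub> (g \<otimes>\<^bsub>?M\<^esub> h)" for f g h
      using eval_at_inj[of "product (product f g) h" "product f (product g h)"]
      by (simp add: product_in eval_simps mult.assoc)
    show "\<one>\<^bsub>?M\<^esub> \<otimes>\<^bsub>?M\<^esub> f = f" if "f \<in> carrier ?M" for f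
      using eval_at_inj[of "product (Poly_Mapping.single u 1) f" f] that
      by (simp add: product_in eval_simps unit_in unit_eval)
    show "f \<otimes>\<^bsub>?M\<^esub> \<one>\<^bsub>?M\<^esub> = f" if "f \<in> carrier ?M" for f
      using eval_at_inj[of "product f (Poly_Mapping.single u 1)" f] that
      by (simp add: product_in eval_simps unit_in unit_eval)
  qed (simp_all add: product_in spanned_single unit_in)
  have ring: "Ring.ring ?M"
    by (rule ringI[OF M mon]) (use bilinear_product in \<open>simp_all add: bilinear_on_def\<close>)
  have module: "Module.module ?R ?M"
    by (rule module.intro[OF R M], unfold_locales)
      (auto simp: ring_of_type_algebra_def spanned_scale lookup_add algebra_simps
        intro!: poly_mapping_eqI)
  show ?thesis
    unfolding assoc_algebra_def assoc_algebra_axioms_def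
    using module ring bilinear_product by (simp add: bilinear_on_def)
qed

end

section \<open>The algebra of classes\<close>

context type_A
begin

abbreviation "root_classes \<equiv> root_class ` Pow {1..<n+1}"

definition representative :: "(('a \<Rightarrow> 'a) \<Rightarrow>\<^sub>0 rat) set \<Rightarrow> nat set" where
  "representative c = (SOME A. A \<subseteq> {1..<n+1} \<and> root_class A = c)"

lemma representative:
  assumes "c \<in> root_classes"
  shows "representative c \<subseteq> {1..<n+1}" "root_class (representative c) = c"
proof -
  have "\<exists>A. A \<subseteq> {1..<n+1} \<and> root_class A = c" using assms by blast
  from someI_ex[OF this] show "representative c \<subseteq> {1..<n+1}" "root_class (representative c) = c"
    by (simp_all only: representative_def)
qed

definition class_mark :: "(('a \<Rightarrow> 'a) \<Rightarrow>\<^sub>0 rat) set \<Rightarrow> nat set \<Rightarrow> rat" where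
  "class_mark c M = of_nat (marks (n+1) (representative c) M)"

lemma class_mark_eq:
  assumes A: "A \<subseteq> {1..<n+1}" and M: "M \<subseteq> {1..<n+1}"
  shows "class_mark (root_class A) M = of_nat (marks (n+1) A M)"
proof -
  have "root_class A \<in> root_classes" using A by blast
  from marks_class_cong[OF representative(1)[OF this] A M representative(2)[OF this]]
  show ?thesis by (simp only: class_mark_def)
qed

text \<open>In a linear relation, choose a class with nonzero coefficient whose sets are as large as possible, and
  evaluate at one of these sets \<open>A\<close>. By triangularity a class with nonzero mark at \<open>A\<close> consists of larger
  sets, where the coefficient vanishes, or is the class of \<open>A\<close>, whose mark at \<open>A\<close> is not zero.\<close>

lemma class_mark_independent:
  assumes f: "f \<in> spanned root_classes"
    and zero: "\<And>M. M \<in> Pow {1..<n+1} \<Longrightarrow> (\<Sum>k\<in>root_classes. Poly_Mapping.lookup f k * class_mark k M) = 0"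
  shows "f = 0"
proof (rule ccontr)
  assume "f \<noteq> 0"
  then obtain k where "Poly_Mapping.lookup f k \<noteq> 0" by (metis poly_mapping_eqI lookup_zero)
  moreover from this have "k \<in> root_classes" using f unfolding spanned_iff by blast
  ultimately have ex: "\<exists>A. A \<subseteq> {1..<n+1} \<and> Poly_Mapping.lookup f (root_class A) \<noteq> 0" by blast
  have bound: "\<forall>A. A \<subseteq> {1..<n+1} \<and> Poly_Mapping.lookup f (root_class A) \<noteq> 0 \<longrightarrow> card A < n + 1"
  proof (intro allI impI)
    fix A assume "A \<subseteq> {1..<n+1} \<and> Poly_Mapping.lookup f (root_class A) \<noteq> 0"
    then have "card A \<le> card {1..<n+1}" by (intro card_mono) simp_all
    then show "card A < n + 1" by simp
  qed
  let ?P = "\<lambda>A. A \<subseteq> {1..<n+1} \<and> Poly_Mapping.lookup f (root_class A) \<noteq> 0"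
  obtain A0 where "?P A0" using ex by blast
  then obtain A where "?P A" and "\<forall>B. ?P B \<longrightarrow> card B \<le> card A"
    using ex_has_greatest_nat[of ?P A0 card "n+1"] bound by metis
  then have A: "A \<subseteq> {1..<n+1}" "Poly_Mapping.lookup f (root_class A) \<noteq> 0"
    and max: "\<And>B. B \<subseteq> {1..<n+1} \<Longrightarrow> Poly_Mapping.lookup f (root_class B) \<noteq> 0 \<Longrightarrow> card B \<le> card A"
    by simp_all
  have vanish: "Poly_Mapping.lookup f k * class_mark k A = 0"
    if k: "k \<in> root_classes - {root_class A}" for k
  proof (rule ccontr)
    obtain B where B: "B \<subseteq> {1..<n+1}" "k = root_class B" using k by blast
    assume "Poly_Mapping.lookup f k * class_mark k A \<noteq> 0"
    then have nz: "Poly_Mapping.lookup f (root_class B) \<noteq> 0" "marks (n+1) B A \<noteq> 0"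
      using class_mark_eq[OF B(1) A(1)] B(2) by auto
    show False
      using marks_nonzero_cases[OF B(1) A(1) nz(2)] max[OF B(1) nz(1)] k B(2) by auto
  qed
  have "(\<Sum>k\<in>root_classes. Poly_Mapping.lookup f k * class_mark k A) =
      (\<Sum>k\<in>{root_class A}. Poly_Mapping.lookup f k * class_mark k A)"
    by (rule sum.mono_neutral_right) (use A(1) vanish in auto)
  then have "Poly_Mapping.lookup f (root_class A) * class_mark (root_class A) A = 0"
    using zero[of A] A(1) by simp
  then show False
    using A marks_self[OF A(1)] class_mark_eq[OF A(1) A(1)] by simp
qed

sublocale separated_basis root_classes "Pow {1..<n+1}" class_mark
  by unfold_locales (simp, rule class_mark_independent)

lemma class_space_eq: "class_space e n = spanned root_classes"
proof -
  have "Pow (simple_roots e n) = image simple ` Pow {1..<n+1}"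
    unfolding simple_roots_eq by (rule image_Pow_surj[OF refl, symmetric])
  then show ?thesis
    by (simp add: class_space_def spanned_def image_image root_class_def)
qed

lemma product_rule_eq:
  assumes A: "A \<subseteq> {1..<n+1}" and B: "B \<subseteq> {1..<n+1}"
  shows "product_rule e n (simple ` A) (simple ` B) =
    (\<Sum>C\<in>Pow B. scale (of_nat (card {w \<in> double_perms (n+1) A B. stab_meet A B w = C}))
      (Poly_Mapping.single (root_class C) 1))"
proof -
  have "Pow (simple ` B) = image simple ` Pow B"
    by (rule image_Pow_surj[OF refl, symmetric])
  moreover have "inj_on (image simple) (Pow B)"
    by (rule inj_on_image_Pow[OF inj_on_subset[OF inj_simple B]])
  ultimately have "product_rule e n (simple ` A) (simple ` B) =
    (\<Sum>C\<in>Pow B. scale (of_nat (struct_const e n (simple ` A) (simple ` B) (simple ` C)))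
      (basis_vec e n (simple ` C)))"
    unfolding product_rule_def by (simp only: sum.reindex comp_def)
  also have "\<dots> = (\<Sum>C\<in>Pow B. scale (of_nat (card {w \<in> double_perms (n+1) A B. stab_meet A B w = C}))
      (Poly_Mapping.single (root_class C) 1))"
  proof (rule sum.cong[OF refl])
    fix C assume "C \<in> Pow B"
    then have "C \<subseteq> {1..<n+1}" using B by blast
    from struct_const_eq[OF A B this]
    show "scale (of_nat (struct_const e n (simple ` A) (simple ` B) (simple ` C)))
        (basis_vec e n (simple ` C)) =
      scale (of_nat (card {w \<in> double_perms (n+1) A B. stab_meet A B w = C}))
        (Poly_Mapping.single (root_class C) 1)"
      by (simp only: basis_vec_def root_class_def)
  qed
  finally show ?thesis .
qed

lemma product_rule_in:
  assumes A: "A \<subseteq> {1..<n+1}" and B: "B \<subseteq> {1..<n+1}"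
  shows "product_rule e n (simple ` A) (simple ` B) \<in> spanned root_classes"
  unfolding product_rule_eq[OF A B]
  by (intro spanned_sum spanned_scale spanned_single imageI) (use B in blast)

text \<open>The structure constant of \<open>C\<close> counts the representatives \<open>w\<close> with \<open>stab_meet A B w = C\<close>, so the rule is
  Mackey's formula with the orbits collected by the parabolic subgroup that they belong to.\<close>

lemma eval_at_product_rule:
  assumes A: "A \<subseteq> {1..<n+1}" and B: "B \<subseteq> {1..<n+1}" and M: "M \<subseteq> {1..<n+1}"
  shows "eval_at (product_rule e n (simple ` A) (simple ` B)) M =
    class_mark (root_class A) M * class_mark (root_class B) M"
proof -
  let ?D = "double_perms (n+1) A B"
  have fin: "finite (Pow B)" using finite_subset[OF B] by simp
  have "eval_at (product_rule e n (simple ` A) (simple ` B)) M =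
    (\<Sum>C\<in>Pow B. of_nat (card {w \<in> ?D. stab_meet A B w = C}) * of_nat (marks (n+1) C M))"
    unfolding product_rule_eq[OF A B] eval_at_sum eval_at_scale
  proof (rule sum.cong[OF refl])
    fix C assume "C \<in> Pow B"
    then have C: "C \<subseteq> {1..<n+1}" using B by blast
    then have "root_class C \<in> root_classes" by blast
    from eval_at_single[OF this, of M] class_mark_eq[OF C M]
    show "of_nat (card {w \<in> ?D. stab_meet A B w = C}) * eval_at (Poly_Mapping.single (root_class C) 1) M
      = of_nat (card {w \<in> ?D. stab_meet A B w = C}) * of_nat (marks (n+1) C M)" by simp
  qed
  also have "\<dots> = of_nat (\<Sum>C\<in>Pow B. \<Sum>w\<in>{w \<in> ?D. stab_meet A B w = C}. marks (n+1) (stab_meet A B w) M)"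
    by simp
  also have "(\<Sum>C\<in>Pow B. \<Sum>w\<in>{w \<in> ?D. stab_meet A B w = C}. marks (n+1) (stab_meet A B w) M) =
      (\<Sum>w\<in>?D. marks (n+1) (stab_meet A B w) M)"
    by (rule sum.group[OF finite_double_perms fin]) (auto simp: stab_meet_def)
  also have "\<dots> = marks (n+1) A M * marks (n+1) B M" by (rule marks_mult[OF A B M, symmetric])
  finally show ?thesis using class_mark_eq[OF A M] class_mark_eq[OF B M] by simp
qed

text \<open>The marks of the product depend on the classes only, and marks determine an element.\<close>

lemma product_rule_cong:
  assumes "A \<subseteq> {1..<n+1}" "B \<subseteq> {1..<n+1}" "A' \<subseteq> {1..<n+1}" "B' \<subseteq> {1..<n+1}"
    and "root_class A = root_class A'" "root_class B = root_class B'"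
  shows "product_rule e n (simple ` A) (simple ` B) = product_rule e n (simple ` A') (simple ` B')"
  using assms by (intro eval_at_inj) (simp_all add: product_rule_in eval_at_product_rule del: One_nat_def)

definition class_prod where
  "class_prod c d = product_rule e n (simple ` representative c) (simple ` representative d)"

sublocale multiplicative_basis root_classes "Pow {1..<n+1}" class_mark class_prod "root_class {1..<n+1}"
proof unfold_locales
  fix c d M assume c: "c \<in> root_classes" and d: "d \<in> root_classes"
  show "class_prod c d \<in> spanned root_classes"
    unfolding class_prod_def by (intro product_rule_in representative c d)
  assume "M \<in> Pow {1..<n+1}"
  then show "eval_at (class_prod c d) M = class_mark c M * class_mark d M"
    using eval_at_product_rule[of "representative c" "representative d" M] representative[OF c] representative[OF d]
    by (simp only: class_prod_def Pow_iff)
next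
  fix M assume "M \<in> Pow {1..<n+1}"
  then show "class_mark (root_class {1..<n+1}) M = 1"
    using class_mark_eq[of "{1..<n+1}" M] marks_full[of M "n+1"] by simp
qed blast

lemma product_extends_rule: "extends_rule e n product"
  unfolding extends_rule_def class_space_eq
proof (intro conjI allI impI bilinear_product)
  fix J K assume JK: "J \<subseteq> simple_roots e n \<and> K \<subseteq> simple_roots e n"
  obtain A where A: "A \<subseteq> {1..<n+1}" "J = simple ` A"
    using JK unfolding simple_roots_eq by (meson subset_imageE)
  obtain B where B: "B \<subseteq> {1..<n+1}" "K = simple ` B"
    using JK unfolding simple_roots_eq by (meson subset_imageE)
  have cls: "root_class A \<in> root_classes" "root_class B \<in> root_classes" using A B by blast+
  have "product (basis_vec e n J) (basis_vec e n K) = class_prod (root_class A) (root_class B)"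
    using product_basis[OF cls] by (simp only: basis_vec_def A(2) B(2) root_class_def)
  also have "\<dots> = product_rule e n J K"
    unfolding class_prod_def A(2) B(2)
    by (intro product_rule_cong representative cls A(1) B(1))
  finally show "product (basis_vec e n J) (basis_vec e n K) = product_rule e n J K" .
qed

lemma extends_rule_unique:
  assumes "extends_rule e n m'" "f \<in> class_space e n" "g \<in> class_space e n"
  shows "m' f g = product f g"
proof (rule bilinear_on_unique[OF finite_basis bilinear_product])
  show "bilinear_on (spanned root_classes) m'" using assms(1) by (simp only: extends_rule_def class_space_eq)
  show "f \<in> spanned root_classes" "g \<in> spanned root_classes" using assms(2,3) by (simp_all only: class_space_eq)
  fix c d assume c: "c \<in> root_classes" and d: "d \<in> root_classes"
  then obtain A B where AB: "A \<subseteq> {1..<n+1}" "B \<subseteq> {1..<n+1}" "c = root_class A" "d = root_class B" by blast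
  have "simple ` A \<subseteq> simple_roots e n" "simple ` B \<subseteq> simple_roots e n"
    using AB(1,2) unfolding simple_roots_eq by blast+
  then show "m' (Poly_Mapping.single c 1) (Poly_Mapping.single d 1) =
      product (Poly_Mapping.single c 1) (Poly_Mapping.single d 1)"
    using assms(1) product_extends_rule
    by (simp add: extends_rule_def AB(3,4) root_class_def basis_vec_def)
qed

lemma class_algebra_product: "assoc_algebra (ring_of_type_algebra :: rat ring) (class_algebra e n product)"
  using assoc_algebra_product unfolding class_algebra_def class_space_eq basis_vec_def root_class_def
  by (simp only: simple_roots_eq)

end

theorem theoremA:
  fixes n :: nat and e :: "nat \<Rightarrow> 'a::euclidean_space"
  assumes "n \<ge> 1"
    and "DIM('a) = n + 1"
    and "\<And>i j. i \<in> {1..n+1} \<Longrightarrow> j \<in> {1..n+1} \<Longrightarrow> e i \<bullet> e j = (if i = j then 1 else 0)"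
  shows "(\<forall>J J' K K'. J \<subseteq> simple_roots e n \<and> J' \<subseteq> simple_roots e n \<and>
            K \<subseteq> simple_roots e n \<and> K' \<subseteq> simple_roots e n \<and>
            x_class e n J = x_class e n J' \<and> x_class e n K = x_class e n K' \<longrightarrow>
            product_rule e n J K = product_rule e n J' K') \<and>
         (\<exists>m. extends_rule e n m \<and>
            (\<forall>m'. extends_rule e n m' \<longrightarrow>
               (\<forall>f\<in>class_space e n. \<forall>g\<in>class_space e n. m' f g = m f g)) \<and>
            assoc_algebra (ring_of_type_algebra :: rat ring) (class_algebra e n m))"
proof -
  interpret type_A n e using assms(2,3) by unfold_locales
  have lift: "\<exists>A. A \<subseteq> {1..<n+1} \<and> L = simple ` A" if "L \<subseteq> simple_roots e n" for L
    using that unfolding simple_roots_eq by (meson subset_imageE)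
  show ?thesis
  proof (intro conjI allI impI exI[where x = product] ballI)
    fix J J' K K'
    assume J: "J \<subseteq> simple_roots e n \<and> J' \<subseteq> simple_roots e n \<and>
      K \<subseteq> simple_roots e n \<and> K' \<subseteq> simple_roots e n \<and>
      x_class e n J = x_class e n J' \<and> x_class e n K = x_class e n K'"
    then obtain A A' B B' where AB: "A \<subseteq> {1..<n+1}" "B \<subseteq> {1..<n+1}" "A' \<subseteq> {1..<n+1}" "B' \<subseteq> {1..<n+1}"
      and eqs: "J = simple ` A" "J' = simple ` A'" "K = simple ` B" "K' = simple ` B'"
      using lift by metis
    have "root_class A = root_class A'" "root_class B = root_class B'"
      using J unfolding root_class_def eqs by simp_all
    then show "product_rule e n J K = product_rule e n J' K'"
      unfolding eqs by (rule product_rule_cong[OF AB])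
  next
    fix m' f g
    assume "extends_rule e n m'" "f \<in> class_space e n" "g \<in> class_space e n"
    then show "m' f g = product f g" by (rule extends_rule_unique)
  qed (rule product_extends_rule class_algebra_product)+
qed

end
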